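(* For $0\le i\le D$ define $$\mathcal N_i=(E^*_0V+E^*_1V+\cdots+E^*_iV)\cap(E_0V+E_1V+\cdots+E_{D-i}V).$$ Then $\sum_{i=0}^D\mathcal N_i$ is equal to the nucleus of $\Gamma$ with respect to $x$.
   Context: Let $\Gamma$ be a finite, undirected, connected graph without loops or multiple edges, with vertex set $X$, path-length distance $\partial$, and diameter $D\ge 1$. Assume $\Gamma$ is distance-regular: for $0\le h,i,j\le D$ and $y,z\in X$ with $\partial(y,z)=h$, the number of $w\in X$ with $\partial(y,w)=i$, $\partial(z,w)=j$ depends only on $h,i,j$. Let $A\in\mathrm{Mat}_X(\mathbb C)$ be the adjacency matrix. Let $V=\mathbb C^X$. Let $E_0,\dots,E_D$ be an ordering of the primitive idempotents of $A$ (projections onto its eigenspaces) with $E_0=|X|^{-1}J$. Define Krein parameters $q^h_{i,j}$ by $E_i\circ E_j=|X|^{-1}\sum_{h}q^h_{i,j}E_h$ ($\circ$ = entrywise product). Assume $\Gamma$ is $Q$-polynomial with respect to $E_0,\dots,E_D$: $q^h_{i,j}=0$ whenever one of $h,i,j$ exceeds the sum of the other two, and $q^h_{i,j}\neq 0$ whenever one of them equals the sum of the other two. Fix $x\in X$. For $0\le i\le D$ let $E^*_i$ be the diagonal matrix with $(y,y)$-entry $1$ if $\partial(x,y)=i$ and $0$ otherwise. Let $A^*$ be the diagonal matrix with $(y,y)$-entry $|X|(E_1)_{x,y}$. Let $T$ be the subalgebra of $\mathrm{Mat}_X(\mathbb C)$ generated by $A$ and $A^*$. A $T$-module is a subspace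 of $V$ invariant under $T$; it is irreducible if it is nonzero and contains no $T$-modules other than $0$ and itself. For an irreducible $T$-module $W$: its endpoint is $r=\min\{i: E^*_iW\ne 0\}$, its dual endpoint is $t=\min\{i:E_iW\neq0\}$, its diameter is $d=|\{i:E^*_iW\ne0\}|-1$, and its displacement is $r+t-D+d$. The nucleus of $\Gamma$ with respect to $x$ is the span of all irreducible $T$-modules of displacement $0$. *)

theory Defs
  imports "HOL-Analysis.Analysis"
begin

text \<open>
  The vertex set of a graph is the universe of a finite type \<open>'v\<close>; the graph is given by its
  adjacency relation. The space \<open>V\<close> is \<open>complex^'v\<close>. Subspaces and spans are complex ones, hence
  the prefix \<open>vec\<close> (scalar multiplication \<open>*s\<close>); the unprefixed \<open>subspace\<close> and \<open>span\<close> would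
  be the real ones. Sums of subspaces are sums of sets.
\<close>

section \<open>Distance-regular graphs\<close>

definition simple_graph :: "('v \<Rightarrow> 'v \<Rightarrow> bool) \<Rightarrow> bool" where
  "simple_graph adj \<longleftrightarrow> symp adj \<and> irreflp adj"

definition connected_graph :: "('v \<Rightarrow> 'v \<Rightarrow> bool) \<Rightarrow> bool" where
  "connected_graph adj \<longleftrightarrow> (\<forall>y z. adj\<^sup>*\<^sup>* y z)"

definition graph_dist :: "('v \<Rightarrow> 'v \<Rightarrow> bool) \<Rightarrow> 'v \<Rightarrow> 'v \<Rightarrow> nat" where
  "graph_dist adj y z = (LEAST n. (adj ^^ n) y z)"

definition graph_diameter :: "('v::finite \<Rightarrow> 'v \<Rightarrow> bool) \<Rightarrow> nat" where
  "graph_diameter adj = Max {graph_dist adj y z | y z. True}"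

definition distance_regular :: "('v::finite \<Rightarrow> 'v \<Rightarrow> bool) \<Rightarrow> bool" where
  "distance_regular adj \<longleftrightarrow>
     simple_graph adj \<and> connected_graph adj \<and>
     (\<forall>h i j. h \<le> graph_diameter adj \<longrightarrow> i \<le> graph_diameter adj \<longrightarrow> j \<le> graph_diameter adj \<longrightarrow>
        (\<exists>p. \<forall>y z. graph_dist adj y z = h \<longrightarrow>
           card {w. graph_dist adj y w = i \<and> graph_dist adj z w = j} = p))"

definition adjacency_matrix :: "('v::finite \<Rightarrow> 'v \<Rightarrow> bool) \<Rightarrow> complex^'v^'v" where
  "adjacency_matrix adj = (\<chi> y z. if adj y z then 1 else 0)"

section \<open>Primitive idempotents and the Q-polynomial property\<close>

definition matrix_scale :: "complex \<Rightarrow> complex^'n^'m \<Rightarrow> complex^'n^'m" where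
  "matrix_scale c M = (\<chi> y z. c * M $ y $ z)"

definition eigenspace :: "complex^'n^'n \<Rightarrow> complex \<Rightarrow> (complex^'n) set" where
  "eigenspace A \<theta> = {v. A *v v = \<theta> *s v}"

text \<open>The projection onto a nonzero eigenspace along the other eigenspaces. It is unique when
  the matrix is diagonalizable, as is the case for an adjacency matrix.\<close>

definition primitive_idempotent :: "complex^'n^'n \<Rightarrow> complex^'n^'n \<Rightarrow> bool" where
  "primitive_idempotent A F \<longleftrightarrow>
     (\<exists>\<theta>. eigenspace A \<theta> \<noteq> {0} \<and> range ((*v) F) = eigenspace A \<theta> \<and>
        (\<forall>v\<in>eigenspace A \<theta>. F *v v = v) \<and>
        (\<forall>\<mu>. \<mu> \<noteq> \<theta> \<longrightarrow> (\<forall>v\<in>eigenspace A \<mu>. F *v v = 0)))"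

definition idempotent_ordering ::
    "('v::finite \<Rightarrow> 'v \<Rightarrow> bool) \<Rightarrow> (nat \<Rightarrow> complex^'v^'v) \<Rightarrow> bool" where
  "idempotent_ordering adj E \<longleftrightarrow>
     bij_betw E {..graph_diameter adj} {F. primitive_idempotent (adjacency_matrix adj) F} \<and>
     E 0 = matrix_scale (1 / of_nat CARD('v)) (\<chi> y z. 1)"

definition hadamard :: "complex^'n^'m \<Rightarrow> complex^'n^'m \<Rightarrow> complex^'n^'m" where
  "hadamard M N = (\<chi> y z. M $ y $ z * N $ y $ z)"

text \<open>\<open>krein D E h i j\<close> is $q^h_{i,j}$. The coefficients with index \<open>h \<le> D\<close> are unique because
  the primitive idempotents are linearly independent; the others are irrelevant.\<close>

definition krein :: "nat \<Rightarrow> (nat \<Rightarrow> complex^'v^'v) \<Rightarrow> nat \<Rightarrow> nat \<Rightarrow> nat \<Rightarrow> complex" where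
  "krein D E h i j =
     (SOME q. hadamard (E i) (E j) = matrix_scale (1 / of_nat CARD('v)) (\<Sum>l\<le>D. matrix_scale (q l) (E l))) h"

definition Q_polynomial :: "nat \<Rightarrow> (nat \<Rightarrow> complex^'v^'v) \<Rightarrow> bool" where
  "Q_polynomial D E \<longleftrightarrow>
     (\<forall>h i j. h \<le> D \<longrightarrow> i \<le> D \<longrightarrow> j \<le> D \<longrightarrow>
        (h > i + j \<or> i > h + j \<or> j > h + i \<longrightarrow> krein D E h i j = 0) \<and>
        (h = i + j \<or> i = h + j \<or> j = h + i \<longrightarrow> krein D E h i j \<noteq> 0))"

section \<open>The subconstituent algebra and its modules\<close>

definition dual_idempotent :: "('v::finite \<Rightarrow> 'v \<Rightarrow> bool) \<Rightarrow> 'v \<Rightarrow> nat \<Rightarrow> complex^'v^'v" where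
  "dual_idempotent adj x i = (\<chi> y z. if y = z \<and> graph_dist adj x y = i then 1 else 0)"

definition dual_adjacency_matrix :: "(nat \<Rightarrow> complex^'v^'v) \<Rightarrow> 'v::finite \<Rightarrow> complex^'v^'v" where
  "dual_adjacency_matrix E x =
     (\<chi> y z. if y = z then of_nat CARD('v) * E 1 $ x $ y else 0)"

definition matrix_subalgebra :: "(complex^'n^'n) set \<Rightarrow> bool" where
  "matrix_subalgebra S \<longleftrightarrow>
     mat 1 \<in> S \<and> (\<forall>M\<in>S. \<forall>N\<in>S. M + N \<in> S \<and> M ** N \<in> S) \<and> (\<forall>c. \<forall>M\<in>S. matrix_scale c M \<in> S)"

definition T_algebra ::
    "('v::finite \<Rightarrow> 'v \<Rightarrow> bool) \<Rightarrow> (nat \<Rightarrow> complex^'v^'v) \<Rightarrow> 'v \<Rightarrow> (complex^'v^'v) set" where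
  "T_algebra adj E x =
     matrix_subalgebra hull {adjacency_matrix adj, dual_adjacency_matrix E x}"

definition matrix_module :: "(complex^'n^'n) set \<Rightarrow> (complex^'n) set \<Rightarrow> bool" where
  "matrix_module T W \<longleftrightarrow> vec.subspace W \<and> (\<forall>B\<in>T. \<forall>w\<in>W. B *v w \<in> W)"

definition irreducible_matrix_module :: "(complex^'n^'n) set \<Rightarrow> (complex^'n) set \<Rightarrow> bool" where
  "irreducible_matrix_module T W \<longleftrightarrow>
     matrix_module T W \<and> W \<noteq> {0} \<and>
     (\<forall>U. matrix_module T U \<and> U \<subseteq> W \<longrightarrow> U = {0} \<or> U = W)"

text \<open>The indices \<open>i \<le> D\<close> with $F_i W \neq 0$.\<close>

definition module_support :: "nat \<Rightarrow> (nat \<Rightarrow> complex^'n^'n) \<Rightarrow> (complex^'n) set \<Rightarrow> nat set" where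
  "module_support D F W = {i. i \<le> D \<and> (*v) (F i) ` W \<noteq> {0}}"

definition endpoint :: "('v::finite \<Rightarrow> 'v \<Rightarrow> bool) \<Rightarrow> 'v \<Rightarrow> (complex^'v) set \<Rightarrow> nat" where
  "endpoint adj x W = Min (module_support (graph_diameter adj) (dual_idempotent adj x) W)"

definition dual_endpoint ::
    "('v::finite \<Rightarrow> 'v \<Rightarrow> bool) \<Rightarrow> (nat \<Rightarrow> complex^'v^'v) \<Rightarrow> (complex^'v) set \<Rightarrow> nat" where
  "dual_endpoint adj E W = Min (module_support (graph_diameter adj) E W)"

definition module_diameter :: "('v::finite \<Rightarrow> 'v \<Rightarrow> bool) \<Rightarrow> 'v \<Rightarrow> (complex^'v) set \<Rightarrow> nat" where
  "module_diameter adj x W =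
     card (module_support (graph_diameter adj) (dual_idempotent adj x) W) - 1"

definition displacement ::
    "('v::finite \<Rightarrow> 'v \<Rightarrow> bool) \<Rightarrow> (nat \<Rightarrow> complex^'v^'v) \<Rightarrow> 'v \<Rightarrow> (complex^'v) set \<Rightarrow> int" where
  "displacement adj E x W =
     int (endpoint adj x W) + int (dual_endpoint adj E W)
       - int (graph_diameter adj) + int (module_diameter adj x W)"

definition nucleus ::
    "('v::finite \<Rightarrow> 'v \<Rightarrow> bool) \<Rightarrow> (nat \<Rightarrow> complex^'v^'v) \<Rightarrow> 'v \<Rightarrow> (complex^'v) set" where
  "nucleus adj E x =
     vec.span (\<Union>{W. irreducible_matrix_module (T_algebra adj E x) W \<and> displacement adj E x W = 0})"

definition nucleus_part ::
    "('v::finite \<Rightarrow> 'v \<Rightarrow> bool) \<Rightarrow> (nat \<Rightarrow> complex^'v^'v) \<Rightarrow> 'v \<Rightarrow> nat \<Rightarrow> (complex^'v) set" where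
  "nucleus_part adj E x i =
     (\<Sum>j\<le>i. range ((*v) (dual_idempotent adj x j))) \<inter>
     (\<Sum>j\<le>graph_diameter adj - i. range ((*v) (E j)))"

end

theory Submission
  imports Defs
begin

text \<open>
  For a \<open>T\<close>-module \<open>W\<close> and a number \<open>K\<close> let \<open>split_sum K W\<close> be the sum over \<open>i + j = K\<close> of the
  subspaces $W \cap (E^*_0V + \cdots + E^*_iV) \cap (E_0V + \cdots + E_jV)$. Since \<open>A\<close> is
  tridiagonal with respect to the $E^*_iV$ and $A^*$ with respect to the $E_jV$, a suitable
  shift of \<open>A\<close> raises \<open>i\<close> and lowers \<open>j\<close> by one, and a suitable shift of $A^*$ does the
  opposite; hence \<open>split_sum K W\<close> is a \<open>T\<close>-module.

  Let \<open>W\<close> be irreducible, with extreme supports $r \le s$ for the $E^*_i$ and $t \le t'$ for the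
  $E_i$; its displacement is $s + t - D$. For $K = s + t$ the module \<open>split_sum K W\<close> contains
  $E_tW \neq 0$, so it is \<open>W\<close>, and therefore $r + t' \le s + t$. The distance matrix $A_D$ and
  its dual $A^*_D = |X| \mathrm{diag}((E_D)_{x,y})$ are injective, lie in \<open>T\<close> and only connect
  indices with sum at least \<open>D\<close>, so $r + s \ge D$ and $t + t' \ge D$, whence $s + t \ge D$. If
  $s + t = D$, then \<open>W = split_sum D W\<close> is contained in $\sum_i \mathcal N_i$. Conversely
  $\sum_i \mathcal N_i$ is a module, so a sum of irreducible ones; for each of these the
  orthogonal projection onto \<open>W\<close> commutes with \<open>T\<close> and shows \<open>W = split_sum D W\<close>, which forces
  $s + t \le D$.
\<close>

section \<open>Self-adjoint operators\<close>

definition self_adjoint :: "('a::real_inner \<Rightarrow> 'a) \<Rightarrow> bool" where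
  "self_adjoint f \<longleftrightarrow> (\<forall>u v. f u \<bullet> v = u \<bullet> f v)"

lemma self_adjointD: "self_adjoint f \<Longrightarrow> f u \<bullet> v = u \<bullet> f v"
  unfolding self_adjoint_def by blast

lemma nonneg_quadratic_imp_linear_coeff_zero:
  fixes b c :: real
  assumes nonneg: "\<And>t. 0 \<le> t * b + t\<^sup>2 * c"
  shows "b = 0"
proof -
  have "\<bar>c\<bar> + 1 \<noteq> 0"
    by linarith
  then obtain s where b_eq: "b = s * (\<bar>c\<bar> + 1)"
    using that[of "b / (\<bar>c\<bar> + 1)"] by simp
  from nonneg have "0 \<le> - s * b + (- s)\<^sup>2 * c"
    by blast
  also have "\<dots> = s\<^sup>2 * (c - \<bar>c\<bar> - 1)"
    by (simp add: b_eq algebra_simps power2_eq_square)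
  finally have "s\<^sup>2 \<le> 0"
    by (auto simp: zero_le_mult_iff)
  then show ?thesis
    by (simp add: b_eq)
qed

lemma self_adjoint_semidefinite_kernel:
  assumes linear: "linear f" and self_adjoint: "self_adjoint f"
    and subspace: "subspace S" and invariant: "f ` S \<subseteq> S"
    and nonneg: "\<And>u. u \<in> S \<Longrightarrow> 0 \<le> f u \<bullet> u"
    and mem: "v \<in> S" and null: "f v \<bullet> v = 0"
  shows "f v = 0"
proof -
  have "0 \<le> t * (2 * (f v \<bullet> f v)) + t\<^sup>2 * (f (f v) \<bullet> f v)" for t
  proof -
    have "f (f v) \<bullet> v = f v \<bullet> f v"
      by (rule self_adjointD[OF self_adjoint])
    then have "f (v + t *\<^sub>R f v) \<bullet> (v + t *\<^sub>R f v) =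
        t * (2 * (f v \<bullet> f v)) + t\<^sup>2 * (f (f v) \<bullet> f v)"
      using null by (simp add: linear_add[OF linear] linear_scale[OF linear] inner_add_left
          inner_add_right power2_eq_square algebra_simps)
    moreover have "v + t *\<^sub>R f v \<in> S"
      using subspace invariant mem by (auto intro!: subspace_add subspace_mul)
    ultimately show ?thesis
      using nonneg by metis
  qed
  from nonneg_quadratic_imp_linear_coeff_zero[OF this] show ?thesis
    by simp
qed

lemma Rayleigh_quotient_attains_max:
  fixes f :: "'a::euclidean_space \<Rightarrow> 'a"
  assumes linear: "linear f" and subspace: "subspace S" and "S \<noteq> {0}"
  obtains v where "v \<in> S" "norm v = 1" "\<And>u. u \<in> S \<Longrightarrow> f u \<bullet> u \<le> (f v \<bullet> v) * (u \<bullet> u)"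
proof -
  let ?sphere = "S \<inter> sphere 0 1"
  have unit: "(1 / norm u) *\<^sub>R u \<in> ?sphere" if "u \<in> S" "u \<noteq> 0" for u
    using that subspace by (auto simp: subspace_mul)
  obtain u\<^sub>0 where "u\<^sub>0 \<in> S" "u\<^sub>0 \<noteq> 0"
    using assms(2,3) subspace_0 by blast
  moreover have "compact ?sphere"
    using closed_subspace[OF subspace] by (intro closed_Int_compact) auto
  moreover have "continuous_on ?sphere (\<lambda>v. f v \<bullet> v)"
    using linear_continuous_on[OF linear_conv_bounded_linear[THEN iffD1, OF linear]]
    by (intro continuous_intros)
  ultimately obtain v where v_mem: "v \<in> ?sphere"
    and v_max: "\<And>u. u \<in> ?sphere \<Longrightarrow> f u \<bullet> u \<le> f v \<bullet> v"
    using continuous_attains_sup[of ?sphere "\<lambda>v. f v \<bullet> v"] unit by blast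
  have "f u \<bullet> u \<le> (f v \<bullet> v) * (u \<bullet> u)" if "u \<in> S" for u
  proof (cases "u = 0")
    case False
    have "f ((1 / norm u) *\<^sub>R u) \<bullet> ((1 / norm u) *\<^sub>R u) \<le> f v \<bullet> v"
      by (rule v_max[OF unit[OF that False]])
    then have "(1 / norm u)\<^sup>2 * (f u \<bullet> u) \<le> f v \<bullet> v"
      by (simp add: linear_scale[OF linear] power2_eq_square)
    then have "f u \<bullet> u \<le> (f v \<bullet> v) * (norm u)\<^sup>2"
      using False by (simp add: field_simps)
    then show ?thesis
      by (simp add: power2_norm_eq_inner)
  qed (simp add: linear_0[OF linear])
  with v_mem show ?thesis
    by (intro that[of v]) auto
qed

lemma self_adjoint_eigenvector_exists:
  fixes f :: "'a::euclidean_space \<Rightarrow> 'a"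
  assumes linear: "linear f" and self_adjoint: "self_adjoint f"
    and subspace: "subspace S" and invariant: "f ` S \<subseteq> S" and nonzero: "S \<noteq> {0}"
  obtains v c where "v \<in> S" "v \<noteq> 0" "f v = c *\<^sub>R v"
proof -
  obtain v where v_mem: "v \<in> S" and v_unit: "norm v = 1"
    and v_max: "\<And>u. u \<in> S \<Longrightarrow> f u \<bullet> u \<le> (f v \<bullet> v) * (u \<bullet> u)"
    using Rayleigh_quotient_attains_max[OF linear subspace nonzero] by blast
  define c where "c = f v \<bullet> v"
  let ?g = "\<lambda>u. c *\<^sub>R u - f u"
  have "?g v = 0"
  proof (rule self_adjoint_semidefinite_kernel[where f = ?g and S = S and v = v])
    show "linear ?g"
      by (intro linear_compose_sub linear_compose_scale_right linear_ident linear)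
    show "self_adjoint ?g"
      unfolding self_adjoint_def inner_diff_left inner_diff_right
      using self_adjointD[OF self_adjoint] by (metis inner_scaleR_left inner_scaleR_right)
    show "?g ` S \<subseteq> S"
      using subspace invariant by (auto intro!: subspace_diff subspace_mul)
    show "0 \<le> ?g u \<bullet> u" if "u \<in> S" for u
      using v_max[OF that] by (simp add: c_def inner_diff_left)
    show "?g v \<bullet> v = 0"
      using v_unit by (simp add: c_def inner_diff_left dot_square_norm)
  qed (fact subspace v_mem)+
  moreover have "v \<noteq> 0"
    using v_unit by auto
  ultimately show ?thesis
    using that[of v c] v_mem by simp
qed

lemma eigencomponent_in_invariant_subspace:
  fixes f :: "'a::real_vector \<Rightarrow> 'a"
  assumes "finite I" "linear f" "subspace S" "f ` S \<subseteq> S" "inj_on \<theta> I"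
    and "\<And>i. i \<in> I \<Longrightarrow> f (e i) = \<theta> i *\<^sub>R e i" "(\<Sum>i\<in>I. e i) \<in> S" "i \<in> I"
  shows "e i \<in> S"
  using assms
proof (induction I arbitrary: e i rule: finite_induct)
  case (insert j I)
  note linear = insert.prems(1) and subspace = insert.prems(2) and invariant = insert.prems(3)
    and inj = insert.prems(4) and eigenvector = insert.prems(5) and sum_mem = insert.prems(6)
  have e_mem: "e k \<in> S" if k_mem: "k \<in> I" for k
  proof -
    define e' where "e' i = (\<theta> i - \<theta> j) *\<^sub>R e i" for i
    have "f (\<Sum>i\<in>insert j I. e i) - \<theta> j *\<^sub>R (\<Sum>i\<in>insert j I. e i) =
        (\<Sum>i\<in>insert j I. e' i)"
      using eigenvector
      by (simp only: linear_sum[OF linear] scaleR_sum_right e'_def scaleR_diff_left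
          sum_subtractf cong: sum.cong)
    also have "\<dots> = (\<Sum>i\<in>I. e' i)"
      using insert.hyps by (simp add: e'_def)
    finally have "(\<Sum>i\<in>I. e' i) \<in> S"
      using subspace invariant sum_mem by (metis image_subset_iff subspace_diff subspace_mul)
    moreover have "f (e' i) = \<theta> i *\<^sub>R e' i" if "i \<in> I" for i
      using eigenvector[of i] that by (simp add: e'_def linear_scale[OF linear])
    ultimately have "e' k \<in> S"
      using insert.IH[of e' k] linear subspace invariant inj k_mem by auto
    moreover have "\<theta> k \<noteq> \<theta> j"
      using inj k_mem insert.hyps by (auto simp: inj_on_def)
    ultimately show ?thesis
      using subspace_mul[OF subspace, of "e' k" "1 / (\<theta> k - \<theta> j)"] by (simp add: e'_def)
  qed
  have "e j = (\<Sum>i\<in>insert j I. e i) - (\<Sum>i\<in>I. e i)"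
    using insert.hyps by simp
  then have "e j \<in> S"
    using subspace sum_mem e_mem by (metis subspace_diff subspace_sum)
  with e_mem insert.prems(7) show ?case by auto
qed simp

section \<open>Modules for sets of matrices\<close>

lemma scaleR_eq_of_real_smult: "c *\<^sub>R (v :: complex^'n) = of_real c *s v"
  by (simp add: vec_eq_iff scaleR_conv_of_real[where 'a = complex])

lemma scaleR_eq_matrix_scale: "c *\<^sub>R M = matrix_scale (of_real c) M"
  by (simp add: vec_eq_iff matrix_scale_def scaleR_conv_of_real[where 'a = complex])

lemma matrix_scale_vector_mult: "matrix_scale c M *v v = c *s (M *v v)"
  by (simp add: vec_eq_iff matrix_scale_def matrix_vector_mult_def sum_distrib_left mult.assoc)

lemma sum_matrix_vector_mult:
  fixes M :: "'i \<Rightarrow> complex^'n^'m"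
  shows "(\<Sum>i\<in>I. M i) *v v = (\<Sum>i\<in>I. M i *v v)"
  by (induction I rule: infinite_finite_induct) (auto simp: matrix_vector_mult_add_rdistrib)

lemma linear_matrix_mult: "linear ((**) (M :: complex^'n^'m))"
  by (rule linearI) (simp_all add: scaleR_eq_matrix_scale vec_eq_iff matrix_matrix_mult_def
      matrix_scale_def sum_distrib_left distrib_left sum.distrib mult_ac)

lemma vec_subspace_imp_subspace:
  fixes S :: "(complex^'n) set"
  assumes "vec.subspace S"
  shows "subspace S"
  using assms by (auto simp: subspace_def vec.subspace_def scaleR_eq_of_real_smult)

lemma set_sum_eq_span_Union:
  fixes S :: "'i \<Rightarrow> (complex^'n) set"
  assumes "finite I" and "\<And>i. i \<in> I \<Longrightarrow> vec.subspace (S i)"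
  shows "(\<Sum>i\<in>I. S i) = vec.span (\<Union>i\<in>I. S i)"
  using assms
proof (induction I rule: finite_induct)
  case (insert j I)
  have "vec.span (S j) = S j"
    using insert.prems by (simp add: vec.span_eq_iff)
  then have "S j + vec.span (\<Union>i\<in>I. S i) = vec.span (S j \<union> (\<Union>i\<in>I. S i))"
    by (auto simp only: vec.span_Un set_plus_def)
  with insert show ?case by simp
qed (simp add: set_zero)

lemma matrix_module_subspace: "matrix_module S W \<Longrightarrow> vec.subspace W"
  by (simp add: matrix_module_def)

lemma matrix_moduleD: "matrix_module S W \<Longrightarrow> M \<in> S \<Longrightarrow> w \<in> W \<Longrightarrow> M *v w \<in> W"
  by (simp add: matrix_module_def)

lemma matrix_module_antimono: "matrix_module S W \<Longrightarrow> R \<subseteq> S \<Longrightarrow> matrix_module R W"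
  by (auto simp: matrix_module_def)

lemma matrix_module_Int: "matrix_module S U \<Longrightarrow> matrix_module S W \<Longrightarrow> matrix_module S (U \<inter> W)"
  by (auto simp: matrix_module_def intro: vec.subspace_inter)

lemma matrix_module_span:
  assumes "\<And>M w. M \<in> S \<Longrightarrow> w \<in> B \<Longrightarrow> M *v w \<in> vec.span B"
  shows "matrix_module S (vec.span B)"
  unfolding matrix_module_def
proof (intro conjI ballI)
  fix M w assume M_mem: "M \<in> S" and w_mem: "w \<in> vec.span B"
  from w_mem have "M *v w \<in> vec.span ((*v) M ` B)"
    by (simp add: vec.span_image)
  also have "\<dots> \<subseteq> vec.span B"
    using assms[OF M_mem] by (intro vec.span_minimal) auto
  finally show "M *v w \<in> vec.span B" .
qed simp

lemma matrix_module_generated: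
  "matrix_module (matrix_subalgebra hull S) W \<longleftrightarrow> matrix_module S W"
proof
  show "matrix_module S W" if "matrix_module (matrix_subalgebra hull S) W"
    using that by (rule matrix_module_antimono) (rule hull_subset)
  assume module: "matrix_module S W"
  have "matrix_subalgebra {M. \<forall>w\<in>W. M *v w \<in> W}"
    using matrix_module_subspace[OF module]
    by (simp add: matrix_subalgebra_def matrix_vector_mult_add_rdistrib vec.subspace_add
        vec.subspace_scale matrix_scale_vector_mult flip: matrix_vector_mul_assoc)
  then have "matrix_subalgebra hull S \<subseteq> {M. \<forall>w\<in>W. M *v w \<in> W}"
    using module by (intro hull_minimal) (auto simp: matrix_module_def)
  with module show "matrix_module (matrix_subalgebra hull S) W"
    by (auto simp: matrix_module_def)
qed

lemma irreducible_matrix_module_generated: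
  "irreducible_matrix_module (matrix_subalgebra hull S) W \<longleftrightarrow> irreducible_matrix_module S W"
  by (simp add: irreducible_matrix_module_def matrix_module_generated)

lemma irreducible_matrix_module_imp_module:
  "irreducible_matrix_module S W \<Longrightarrow> matrix_module S W"
  by (simp add: irreducible_matrix_module_def)

lemma irreducible_matrix_module_nonzero: "irreducible_matrix_module S W \<Longrightarrow> W \<noteq> {0}"
  by (simp add: irreducible_matrix_module_def)

lemma irreducible_matrix_module_eqI:
  "irreducible_matrix_module S W \<Longrightarrow> matrix_module S U \<Longrightarrow> U \<subseteq> W \<Longrightarrow> U \<noteq> {0} \<Longrightarrow> U = W"
  by (auto simp: irreducible_matrix_module_def)

lemma irreducible_submodule_exists:
  assumes "matrix_module S M" "M \<noteq> {0}"
  obtains W where "irreducible_matrix_module S W" "W \<subseteq> M"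
proof -
  let ?submodule = "\<lambda>W. matrix_module S W \<and> W \<noteq> {0} \<and> W \<subseteq> M"
  obtain W where W_submodule: "?submodule W"
    and W_minimal: "\<And>U. ?submodule U \<Longrightarrow> vec.dim W \<le> vec.dim U"
    using assms ex_has_least_nat[of ?submodule M vec.dim] by auto
  have "U = W" if "matrix_module S U" "U \<subseteq> W" "U \<noteq> {0}" for U
  proof (rule vec.subspace_dim_equal)
    show "vec.dim W \<le> vec.dim U"
      using that W_submodule by (intro W_minimal) auto
  qed (use that W_submodule in \<open>auto dest: matrix_module_subspace\<close>)
  with W_submodule that show ?thesis
    unfolding irreducible_matrix_module_def by blast
qed

lemma generated_subalgebra_scalar_on:
  assumes M_mem: "M \<in> matrix_subalgebra hull {A}" and A_scalar: "\<And>v. v \<in> S \<Longrightarrow> A *v v = a *s v"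
  obtains c where "\<forall>v\<in>S. M *v v = c *s v"
proof -
  define scalar where "scalar M c \<longleftrightarrow> (\<forall>v\<in>S. M *v v = c *s v)" for M c
  have "matrix_subalgebra {M. \<exists>c. scalar M c}"
    unfolding matrix_subalgebra_def
  proof safe
    have "scalar (mat 1) 1"
      by (simp add: scalar_def)
    then show "\<exists>c. scalar (mat 1) c" ..
    fix M N a b assume "scalar M a" "scalar N b"
    then have "scalar (M + N) (a + b)" "scalar (M ** N) (a * b)"
      by (simp_all add: scalar_def matrix_vector_mult_add_rdistrib vec.scale_left_distrib
          vector_scalar_commute mult.commute flip: matrix_vector_mul_assoc)
    then show "\<exists>c. scalar (M + N) c" "\<exists>c. scalar (M ** N) c" by blast+
  next
    fix d M c assume "scalar M c"
    then have "scalar (matrix_scale d M) (d * c)"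
      by (simp add: scalar_def matrix_scale_vector_mult)
    then show "\<exists>c. scalar (matrix_scale d M) c" ..
  qed
  then have "matrix_subalgebra hull {A} \<subseteq> {M. \<exists>c. scalar M c}"
    using A_scalar by (intro hull_minimal) (auto simp: scalar_def)
  with M_mem obtain c where "scalar M c" by blast
  with that show ?thesis
    unfolding scalar_def by blast
qed

section \<open>Orthogonal complements and projections\<close>

text \<open>Complements are taken for the real inner product, which is the real part of the Hermitian
  one; for a complex subspace both complements agree.\<close>

lemma inner_smult_right: "u \<bullet> (c *s v) = (cnj c *s u) \<bullet> (v :: complex^'n)"
  by (simp add: inner_vec_def inner_complex_def algebra_simps)

lemma vec_subspace_orthogonal_comp:
  fixes S :: "(complex^'n) set"
  assumes "vec.subspace S"
  shows "vec.subspace (S\<^sup>\<bottom>)"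
  using assms unfolding vec.subspace_def orthogonal_comp_def orthogonal_def
  by (auto simp: inner_add_right inner_smult_right)

lemma matrix_module_orthogonal_comp:
  assumes self_adjoint: "\<And>M. M \<in> S \<Longrightarrow> self_adjoint ((*v) M)" and module: "matrix_module S W"
  shows "matrix_module S (W\<^sup>\<bottom>)"
  unfolding matrix_module_def
proof (intro conjI ballI)
  show "vec.subspace (W\<^sup>\<bottom>)"
    using module by (intro vec_subspace_orthogonal_comp matrix_module_subspace)
  fix M v assume M_mem: "M \<in> S" and v_perp: "v \<in> W\<^sup>\<bottom>"
  have "w \<bullet> (M *v v) = 0" if "w \<in> W" for w
    using v_perp matrix_moduleD[OF module M_mem that]
      self_adjointD[OF self_adjoint[OF M_mem], of w v]
    by (simp add: orthogonal_comp_def orthogonal_def)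
  then show "M *v v \<in> W\<^sup>\<bottom>"
    by (simp add: orthogonal_comp_def orthogonal_def)
qed

lemma orthogonal_comp_Int_zero: "u \<in> S \<Longrightarrow> u \<in> S\<^sup>\<bottom> \<Longrightarrow> u = 0"
  by (auto simp: orthogonal_comp_def orthogonal_def)

lemma matrix_module_eq_span_irreducible:
  assumes self_adjoint: "\<And>M. M \<in> S \<Longrightarrow> self_adjoint ((*v) M)" and module: "matrix_module S U"
  shows "U = vec.span (\<Union>{W. irreducible_matrix_module S W \<and> W \<subseteq> U})" (is "_ = ?sum")
proof (rule ccontr)
  assume "U \<noteq> ?sum"
  moreover have "?sum \<subseteq> U"
    using matrix_module_subspace[OF module] by (intro vec.span_minimal) auto
  ultimately have "span ?sum \<subset> span U"
    using module
    by (simp add: span_eq_iff[THEN iffD2] vec_subspace_imp_subspace matrix_module_subspace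
        psubset_eq)
  then obtain u where u_perp: "u \<noteq> 0" "u \<in> span U" "\<And>y. y \<in> span ?sum \<Longrightarrow> orthogonal u y"
    by (rule orthogonal_to_subspace_exists_gen) blast
  then have "u \<in> U" "u \<in> ?sum\<^sup>\<bottom>"
    using module
    by (auto simp: span_eq_iff[THEN iffD2] vec_subspace_imp_subspace matrix_module_subspace
        orthogonal_comp_def orthogonal_commute span_base)
  with u_perp(1) have "U \<inter> ?sum\<^sup>\<bottom> \<noteq> {0}" by blast
  moreover have "matrix_module S ?sum"
    by (rule matrix_module_span)
      (auto simp: irreducible_matrix_module_def intro!: vec.span_base dest: matrix_moduleD)
  then have "matrix_module S (U \<inter> ?sum\<^sup>\<bottom>)"
    using matrix_module_Int matrix_module_orthogonal_comp self_adjoint module by blast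
  ultimately obtain W where W_irreducible: "irreducible_matrix_module S W" "W \<subseteq> U \<inter> ?sum\<^sup>\<bottom>"
    using irreducible_submodule_exists by blast
  then have "W \<subseteq> ?sum"
    using vec.span_superset[of "\<Union>{W. irreducible_matrix_module S W \<and> W \<subseteq> U}"] by blast
  with W_irreducible(2) have "W \<subseteq> {0}"
    using orthogonal_comp_Int_zero by blast
  with W_irreducible(1) show False
    using irreducible_matrix_module_nonzero irreducible_matrix_module_imp_module
      matrix_module_subspace vec.subspace_0 by blast
qed

definition orthogonal_projection :: "(complex^'n) set \<Rightarrow> complex^'n^'n" where
  "orthogonal_projection S = matrix (\<lambda>v. THE p. p \<in> S \<and> v - p \<in> S\<^sup>\<bottom>)"

lemma ex1_orthogonal_decomposition:
  fixes S :: "'a::euclidean_space set"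
  assumes "subspace S"
  shows "\<exists>!p. p \<in> S \<and> v - p \<in> S\<^sup>\<bottom>"
proof (rule ex_ex1I)
  have "v \<in> S + S\<^sup>\<bottom>"
    using subspace_sum_orthogonal_comp[OF assms] by simp
  then show "\<exists>p. p \<in> S \<and> v - p \<in> S\<^sup>\<bottom>"
    by (auto simp: set_plus_def)
  fix p q assume decompositions: "p \<in> S \<and> v - p \<in> S\<^sup>\<bottom>" "q \<in> S \<and> v - q \<in> S\<^sup>\<bottom>"
  then have "p - q \<in> S"
    using assms by (simp add: subspace_diff)
  moreover have "(v - q) - (v - p) \<in> S\<^sup>\<bottom>"
    using decompositions subspace_orthogonal_comp by (blast intro: subspace_diff)
  ultimately show "p = q"
    using orthogonal_comp_Int_zero[of "p - q" S] by simp
qed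

lemma orthogonal_projection_works:
  fixes S :: "(complex^'n) set"
  assumes subspace: "vec.subspace S"
  shows "orthogonal_projection S *v v \<in> S \<and> v - orthogonal_projection S *v v \<in> S\<^sup>\<bottom>"
proof -
  define p where "p v = (THE p. p \<in> S \<and> v - p \<in> S\<^sup>\<bottom>)" for v
  note ex1 = ex1_orthogonal_decomposition[OF vec_subspace_imp_subspace[OF subspace]]
  have p_works: "p v \<in> S" "v - p v \<in> S\<^sup>\<bottom>" for v
    using theI'[OF ex1[of v]] by (auto simp: p_def)
  have p_eqI: "p v = q" if "q \<in> S" "v - q \<in> S\<^sup>\<bottom>" for v q
    using that p_works ex1 by blast
  have "Vector_Spaces.linear (*s) (*s) p"
  proof (unfold Vector_Spaces.linear_iff, intro conjI allI vec.vector_space_axioms)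
    note S_perp = vec_subspace_orthogonal_comp[OF subspace]
    fix u v and c :: complex
    have "u + v - (p u + p v) = (u - p u) + (v - p v)" "c *s u - c *s p u = c *s (u - p u)"
      by (simp_all add: vec.scale_right_diff_distrib)
    then have "u + v - (p u + p v) \<in> S\<^sup>\<bottom>" "c *s u - c *s p u \<in> S\<^sup>\<bottom>"
      using p_works S_perp by (metis vec.subspace_add, metis vec.subspace_scale)
    then show "p (u + v) = p u + p v" "p (c *s u) = c *s p u"
      using p_works subspace by (auto intro!: p_eqI vec.subspace_add vec.subspace_scale)
  qed
  then have "orthogonal_projection S *v v = p v"
    by (simp add: orthogonal_projection_def matrix_works flip: p_def)
  with p_works show ?thesis by simp
qed

lemma orthogonal_projection_mem: "vec.subspace S \<Longrightarrow> orthogonal_projection S *v v \<in> S"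
  using orthogonal_projection_works by blast

lemma orthogonal_projection_eqI:
  assumes "vec.subspace S" "p \<in> S" "v - p \<in> S\<^sup>\<bottom>"
  shows "orthogonal_projection S *v v = p"
  using orthogonal_projection_works[OF assms(1)] assms(2,3)
    ex1_orthogonal_decomposition[OF vec_subspace_imp_subspace[OF assms(1)]] by blast

lemma orthogonal_projection_id: "vec.subspace S \<Longrightarrow> v \<in> S \<Longrightarrow> orthogonal_projection S *v v = v"
  by (rule orthogonal_projection_eqI) (auto simp: orthogonal_comp_def orthogonal_def)

lemma orthogonal_projection_zero:
  "vec.subspace S \<Longrightarrow> v \<in> S\<^sup>\<bottom> \<Longrightarrow> orthogonal_projection S *v v = 0"
  by (rule orthogonal_projection_eqI) (auto simp: vec.subspace_0)

lemma orthogonal_projection_commute: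
  assumes "matrix_module {M} S" "matrix_module {M} (S\<^sup>\<bottom>)"
  shows "orthogonal_projection S *v (M *v v) = M *v (orthogonal_projection S *v v)"
proof -
  note subspace = matrix_module_subspace[OF assms(1)]
  have "M *v (orthogonal_projection S *v v) \<in> S"
    using assms(1) orthogonal_projection_mem[OF subspace] by (simp add: matrix_moduleD)
  moreover have "M *v (v - orthogonal_projection S *v v) \<in> S\<^sup>\<bottom>"
    using assms(2) orthogonal_projection_works[OF subspace] by (simp add: matrix_moduleD)
  ultimately show ?thesis
    by (intro orthogonal_projection_eqI[OF subspace])
      (simp_all add: matrix_vector_mult_diff_distrib)
qed

section \<open>Spectral decompositions\<close>

locale spectral_decomposition =
  fixes D :: nat and A :: "complex^'n^'n" and E :: "nat \<Rightarrow> complex^'n^'n" and \<theta> :: "nat \<Rightarrow> real"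
  assumes sum_E: "(\<Sum>i\<le>D. E i *v v) = v"
    and E_E: "i \<le> D \<Longrightarrow> j \<le> D \<Longrightarrow> E i *v (E j *v v) = (if i = j then E j *v v else 0)"
    and A_E: "i \<le> D \<Longrightarrow> A *v (E i *v v) = of_real (\<theta> i) *s (E i *v v)"
    and inj_\<theta>: "inj_on \<theta> {..D}"
begin

lemma E_A:
  assumes "j \<le> D"
  shows "E j *v (A *v w) = of_real (\<theta> j) *s (E j *v w)"
proof -
  have "E j *v (A *v w) = (\<Sum>i\<le>D. E j *v (A *v (E i *v w)))"
    by (simp add: sum_E flip: vec.sum)
  also have "\<dots> = (\<Sum>i\<le>D. if j = i then of_real (\<theta> j) *s (E j *v w) else 0)"
    by (intro sum.cong) (auto simp: A_E E_E vector_scalar_commute assms)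
  finally show ?thesis
    using assms by simp
qed

lemma E_zero_imp_zero: "(\<And>i. i \<le> D \<Longrightarrow> E i *v w = 0) \<Longrightarrow> w = 0"
  using sum_E[of w] by simp

lemma matrix_module_E_mem:
  assumes module: "matrix_module {A} W" and i_le: "i \<le> D" and w_mem: "w \<in> W"
  shows "E i *v w \<in> W"
proof (rule eigencomponent_in_invariant_subspace[where f = "(*v) A" and I = "{..D}" and \<theta> = \<theta>])
  show "subspace W"
    using module by (intro vec_subspace_imp_subspace matrix_module_subspace)
  show "(*v) A ` W \<subseteq> W"
    using matrix_moduleD[OF module] by blast
  show "A *v (E j *v w) = \<theta> j *\<^sub>R (E j *v w)" if "j \<in> {..D}" for j
    using that by (simp add: A_E scaleR_eq_of_real_smult)
qed (use i_le w_mem inj_\<theta> in \<open>simp_all add: sum_E\<close>)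

lemma matrix_module_E: "matrix_module {A} W \<Longrightarrow> i \<le> D \<Longrightarrow> matrix_module {E i} W"
  by (simp add: matrix_module_def[of "{E i}"] matrix_module_E_mem matrix_module_subspace)

lemma generated_subalgebra_expansion:
  assumes "M \<in> matrix_subalgebra hull {A}"
  obtains c where "M = (\<Sum>l\<le>D. matrix_scale (c l) (E l))"
proof -
  have "\<exists>c. \<forall>v. M *v (E l *v v) = c *s (E l *v v)" if "l \<le> D" for l
  proof -
    have "A *v u = of_real (\<theta> l) *s u" if "u \<in> range ((*v) (E l))" for u
      using A_E[OF \<open>l \<le> D\<close>] that by auto
    then obtain c where "\<forall>u\<in>range ((*v) (E l)). M *v u = c *s u"
      by (rule generated_subalgebra_scalar_on[OF assms])
    then show ?thesis by blast
  qed
  then obtain c where c_eigenvalue: "\<And>l v. l \<le> D \<Longrightarrow> M *v (E l *v v) = c l *s (E l *v v)"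
    by metis
  have "M *v v = (\<Sum>l\<le>D. matrix_scale (c l) (E l)) *v v" for v
  proof -
    have "M *v v = (\<Sum>l\<le>D. M *v (E l *v v))"
      by (simp add: sum_E flip: vec.sum)
    then show ?thesis
      by (simp add: c_eigenvalue sum_matrix_vector_mult matrix_scale_vector_mult)
  qed
  then have "M = (\<Sum>l\<le>D. matrix_scale (c l) (E l))"
    by (simp add: matrix_eq)
  then show ?thesis by (rule that)
qed

text \<open>The subspace $E_0V + \cdots + E_mV$.\<close>

definition flag :: "nat \<Rightarrow> (complex^'n) set" where
  "flag m = {v. \<forall>j\<le>D. m < j \<longrightarrow> E j *v v = 0}"

lemma flag_iff: "v \<in> flag m \<longleftrightarrow> (\<forall>j\<le>D. m < j \<longrightarrow> E j *v v = 0)"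
  by (simp add: flag_def)

lemma sum_range_E_eq_flag:
  assumes "m \<le> D"
  shows "(\<Sum>j\<le>m. range ((*v) (E j))) = flag m"
proof (intro subset_antisym subsetI)
  fix v assume "v \<in> (\<Sum>j\<le>m. range ((*v) (E j)))"
  then obtain u where "v = (\<Sum>k\<le>m. E k *v u k)"
    unfolding set_sum_alt[OF finite_atMost] image_iff by (auto simp: image_iff dest!: bchoice)
  then show "v \<in> flag m"
    using assms by (auto simp: flag_iff vec.sum E_E)
next
  fix v assume "v \<in> flag m"
  then have "(\<Sum>k\<le>D. E k *v v) = (\<Sum>k\<le>m. E k *v v)"
    using assms by (intro sum.mono_neutral_right) (auto simp: flag_iff)
  then have "v = (\<Sum>k\<le>m. E k *v v)"
    by (simp add: sum_E)
  then show "v \<in> (\<Sum>j\<le>m. range ((*v) (E j)))"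
    unfolding set_sum_alt[OF finite_atMost] by blast
qed

lemma subspace_flag: "vec.subspace (flag m)"
  by (auto simp: flag_def vec.subspace_def matrix_vector_right_distrib vector_scalar_commute)

lemma flag_Suc_subset: "flag m \<subseteq> flag (Suc m)"
  by (auto simp: flag_def)

lemma flag_bound: "v \<in> flag m \<Longrightarrow> j \<le> D \<Longrightarrow> E j *v v \<noteq> 0 \<Longrightarrow> j \<le> m"
  by (meson flag_iff not_le)

lemma E_in_flag: "i \<le> D \<Longrightarrow> i \<le> m \<Longrightarrow> E i *v v \<in> flag m"
  by (auto simp: flag_def E_E)

lemma matrix_module_flag: "matrix_module {A} (flag m)"
  using subspace_flag by (auto simp: matrix_module_def flag_def E_A)

lemma A_on_flag_0: "v \<in> flag 0 \<Longrightarrow> A *v v = of_real (\<theta> 0) *s v"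
  using sum_E[of v] A_E[of 0 v] sum.remove[of "{..D}" 0 "\<lambda>i. E i *v v"] by (simp add: flag_def)

lemma A_shift_flag_Suc:
  assumes "v \<in> flag (Suc m)"
  obtains c where "A *v v - c *s v \<in> flag m"
proof -
  let ?c = "of_real (\<theta> (Suc m)) :: complex"
  have "E j *v (A *v v - ?c *s v) = 0" if "j \<le> D" "m < j" for j
  proof -
    have "j = Suc m \<or> E j *v v = 0"
      using assms that by (auto simp: flag_iff intro: Suc_lessI)
    moreover have "E j *v (A *v v - ?c *s v) = (of_real (\<theta> j) - ?c) *s (E j *v v)"
      by (simp add: matrix_vector_mult_diff_distrib E_A that(1) vector_scalar_commute
          vec.scale_left_diff_distrib)
    ultimately show ?thesis by auto
  qed
  then show ?thesis
    by (intro that[of ?c]) (simp add: flag_iff)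
qed

abbreviation supp :: "(complex^'n) set \<Rightarrow> nat set" where
  "supp W \<equiv> module_support D E W"

lemma supp_iff:
  "vec.subspace W \<Longrightarrow> i \<in> supp W \<longleftrightarrow> i \<le> D \<and> (\<exists>w\<in>W. E i *v w \<noteq> 0)"
  using vec.subspace_0[of W] by (fastforce simp: module_support_def)

lemma finite_supp: "finite (supp W)"
  by (simp add: module_support_def)

lemma supp_nonempty:
  assumes "vec.subspace W" "W \<noteq> {0}"
  shows "supp W \<noteq> {}"
proof -
  obtain w where "w \<in> W" "w \<noteq> 0"
    using assms vec.subspace_0[of W] by blast
  then show ?thesis
    using E_zero_imp_zero[of w] supp_iff[OF assms(1)] by blast
qed

lemma supp_bounds:
  assumes "vec.subspace W" "w \<in> W" "i \<le> D" "E i *v w \<noteq> 0"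
  shows "Min (supp W) \<le> i" and "i \<le> Max (supp W)"
  using assms finite_supp supp_iff by (auto intro!: Min_le Max_ge)

lemma Min_supp_attained:
  assumes "vec.subspace W" "W \<noteq> {0}"
  obtains w where "w \<in> W" "Min (supp W) \<le> D" "E (Min (supp W)) *v w \<noteq> 0"
  using Min_in[OF finite_supp supp_nonempty[OF assms]] supp_iff[OF assms(1)] that by blast

lemma Max_supp_attained:
  assumes "vec.subspace W" "W \<noteq> {0}"
  obtains w where "w \<in> W" "Max (supp W) \<le> D" "E (Max (supp W)) *v w \<noteq> 0"
  using Max_in[OF finite_supp supp_nonempty[OF assms]] supp_iff[OF assms(1)] that by blast

lemma Min_plus_Max_supp_ge:
  assumes module: "matrix_module {A, C} W" "W \<noteq> {0}"
    and C_inj: "\<And>v. C *v v = 0 \<Longrightarrow> v = 0"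
    and C_far: "\<And>h j v. h \<le> D \<Longrightarrow> j \<le> D \<Longrightarrow> h + j < D \<Longrightarrow> E h *v (C *v (E j *v v)) = 0"
  shows "D \<le> Min (supp W) + Max (supp W)"
proof -
  let ?r = "Min (supp W)"
  note subspace = matrix_module_subspace[OF module(1)]
  obtain v where v_attains_Min: "v \<in> W" "?r \<le> D" "E ?r *v v \<noteq> 0"
    by (rule Min_supp_attained[OF subspace module(2)])
  then obtain h where h_attained: "h \<le> D" "E h *v (C *v (E ?r *v v)) \<noteq> 0"
    using C_inj E_zero_imp_zero by blast
  then have "D \<le> h + ?r"
    using C_far[of h ?r v] v_attains_Min(2) by force
  moreover have "E ?r *v v \<in> W"
    using matrix_module_E_mem[of W] matrix_module_antimono[OF module(1)] v_attains_Min by blast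
  then have "C *v (E ?r *v v) \<in> W"
    using matrix_moduleD[OF module(1)] by blast
  then have "h \<le> Max (supp W)"
    using supp_bounds(2)[OF subspace _ h_attained] by blast
  ultimately show ?thesis by linarith
qed

end

locale tridiagonal_system = spectral_decomposition D A E \<theta>
  for D :: nat and A :: "complex^'n^'n" and E :: "nat \<Rightarrow> complex^'n^'n" and \<theta> :: "nat \<Rightarrow> real" +
  fixes B :: "complex^'n^'n"
  assumes tridiagonal:
    "h \<le> D \<Longrightarrow> j \<le> D \<Longrightarrow> h > Suc j \<or> j > Suc h \<Longrightarrow> E h *v (B *v (E j *v v)) = 0"
begin

lemma B_flag:
  assumes "v \<in> flag m"
  shows "B *v v \<in> flag (Suc m)"
  unfolding flag_iff
proof (intro allI impI)
  fix j assume j_far: "j \<le> D" "Suc m < j"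
  have "E j *v (B *v v) = (\<Sum>k\<le>D. E j *v (B *v (E k *v v)))"
    by (simp add: sum_E flip: vec.sum)
  also have "\<dots> = 0"
  proof (intro sum.neutral ballI)
    fix k assume "k \<in> {..D}"
    then show "E j *v (B *v (E k *v v)) = 0"
      using assms j_far tridiagonal[of j k v] by (cases "m < k") (auto simp: flag_iff)
  qed
  finally show "E j *v (B *v v) = 0" .
qed

lemma matrix_module_Int_flag:
  assumes module: "matrix_module {A, B} W" and gap: "Suc m \<notin> supp W"
  shows "matrix_module {A, B} (W \<inter> flag m)"
proof -
  note subspace = matrix_module_subspace[OF module]
  have "B *v w \<in> W \<inter> flag m" if w_mem: "w \<in> W \<inter> flag m" for w
  proof -
    have "B *v w \<in> W"
      using matrix_moduleD[OF module] w_mem by blast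
    moreover from this have "Suc m \<le> D \<Longrightarrow> E (Suc m) *v (B *v w) = 0"
      using gap supp_iff[OF subspace] by blast
    then have "B *v w \<in> flag m"
      using B_flag[of w m] w_mem by (auto simp: flag_iff) (metis Suc_lessI)
    ultimately show ?thesis by blast
  qed
  moreover have "matrix_module {A} (W \<inter> flag m)"
    using matrix_module_antimono[OF module] by (intro matrix_module_Int matrix_module_flag) auto
  ultimately show ?thesis
    by (simp add: matrix_module_def)
qed

lemma irreducible_supp_interval:
  assumes irreducible: "irreducible_matrix_module {A, B} W"
  shows "supp W = {Min (supp W)..Max (supp W)}"
proof (rule ccontr)
  note module = irreducible_matrix_module_imp_module[OF irreducible]
  note subspace = matrix_module_subspace[OF module]
    and nonzero = irreducible_matrix_module_nonzero[OF irreducible]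
  obtain v where v_attains_Min: "v \<in> W" "Min (supp W) \<le> D" "E (Min (supp W)) *v v \<noteq> 0"
    by (rule Min_supp_attained[OF subspace nonzero])
  obtain w where w_attains_Max: "w \<in> W" "Max (supp W) \<le> D" "E (Max (supp W)) *v w \<noteq> 0"
    by (rule Max_supp_attained[OF subspace nonzero])
  assume "supp W \<noteq> {Min (supp W)..Max (supp W)}"
  moreover have "supp W \<subseteq> {Min (supp W)..Max (supp W)}"
    using finite_supp[of W] by auto
  ultimately obtain i where i_gap: "Min (supp W) \<le> i" "i \<le> Max (supp W)" "i \<notin> supp W"
    by (metis atLeastAtMost_iff subsetI subset_antisym)
  moreover have "Min (supp W) \<in> supp W"
    using finite_supp supp_nonempty[OF subspace nonzero] by (rule Min_in)
  ultimately obtain m where m_below_gap: "i = Suc m" "Min (supp W) \<le> m"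
    by (cases i) (auto simp: le_Suc_eq)
  have "E (Min (supp W)) *v v \<in> W \<inter> flag m"
    using v_attains_Min m_below_gap(2) matrix_module_E_mem[OF matrix_module_antimono[OF module]]
    by (auto intro: E_in_flag)
  then have "W \<inter> flag m = W"
    using irreducible_matrix_module_eqI[OF irreducible matrix_module_Int_flag[OF module]]
      i_gap(3) m_below_gap(1) v_attains_Min(3) by blast
  then have "Max (supp W) \<le> m"
    using flag_bound w_attains_Max by blast
  with i_gap(2) m_below_gap(1) show False by simp
qed

lemma irreducible_Min_supp_plus_card:
  assumes irreducible: "irreducible_matrix_module {A, B} W"
  shows "Min (supp W) + (card (supp W) - 1) = Max (supp W)"
proof -
  have "card (supp W) = Suc (Max (supp W)) - Min (supp W)"
    using irreducible_supp_interval[OF irreducible] by (metis card_atLeastAtMost)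
  moreover have "supp W \<noteq> {}"
    using irreducible by (intro supp_nonempty)
      (auto intro: matrix_module_subspace simp: irreducible_matrix_module_def)
  then have "Min (supp W) \<le> Max (supp W)"
    using finite_supp[of W] by (simp add: Max_ge_iff)
  ultimately show ?thesis by linarith
qed

end

section \<open>Tridiagonal pairs\<close>

locale tridiagonal_pair =
  P: tridiagonal_system D A E \<theta> As + Q: tridiagonal_system D As Es \<theta>s A
  for D :: nat and A :: "complex^'n^'n" and E \<theta> and As :: "complex^'n^'n" and Es \<theta>s +
  assumes self_adjoint_A: "self_adjoint ((*v) A)" and self_adjoint_As: "self_adjoint ((*v) As)"
begin

lemma swap: "tridiagonal_pair D As Es \<theta>s A E \<theta>"
  using self_adjoint_A self_adjoint_As by unfold_locales

definition split_sum :: "nat \<Rightarrow> (complex^'n) set \<Rightarrow> (complex^'n) set" where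
  "split_sum K W = vec.span {w \<in> W. \<exists>i j. i + j = K \<and> w \<in> Q.flag i \<and> w \<in> P.flag j}"

lemma split_sum_swap: "tridiagonal_pair.split_sum D Es E K W = split_sum K W"
  unfolding split_sum_def tridiagonal_pair.split_sum_def[OF swap]
  by (metis (no_types, opaque_lifting) add.commute)

lemma subspace_split_sum: "vec.subspace (split_sum K W)"
  by (simp add: split_sum_def)

lemma split_sum_base:
  "w \<in> W \<Longrightarrow> w \<in> Q.flag i \<Longrightarrow> w \<in> P.flag j \<Longrightarrow> w \<in> split_sum (i + j) W"
  unfolding split_sum_def by (rule vec.span_base) blast

lemma split_sum_mono: "U \<subseteq> W \<Longrightarrow> split_sum K U \<subseteq> split_sum K W"
  unfolding split_sum_def by (intro vec.span_mono) blast

lemma split_sum_subset: "vec.subspace W \<Longrightarrow> split_sum K W \<subseteq> W"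
  unfolding split_sum_def by (intro vec.span_minimal) auto

lemma matrix_split_sum_mem:
  assumes "\<And>i j w. i + j = K \<Longrightarrow> w \<in> W \<Longrightarrow> w \<in> Q.flag i \<Longrightarrow> w \<in> P.flag j \<Longrightarrow> M *v w \<in> U"
    and "vec.subspace U" and "w \<in> split_sum K W"
  shows "M *v w \<in> U"
proof -
  let ?B = "{w \<in> W. \<exists>i j. i + j = K \<and> w \<in> Q.flag i \<and> w \<in> P.flag j}"
  have "M *v w \<in> vec.span ((*v) M ` ?B)"
    using assms(3) unfolding split_sum_def vec.span_image by blast
  also have "\<dots> \<subseteq> U"
    using assms(1,2) by (intro vec.span_minimal) blast+
  finally show ?thesis .
qed

lemma sum_flags_eq_split_sum: "(\<Sum>i\<le>D. Q.flag i \<inter> P.flag (D - i)) = split_sum D UNIV"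
proof -
  have "(\<Sum>i\<le>D. Q.flag i \<inter> P.flag (D - i)) = vec.span (\<Union>i\<le>D. Q.flag i \<inter> P.flag (D - i))"
    by (intro set_sum_eq_span_Union vec.subspace_inter Q.subspace_flag P.subspace_flag) simp
  also have "(\<Union>i\<le>D. Q.flag i \<inter> P.flag (D - i)) =
      {w \<in> UNIV. \<exists>i j. i + j = D \<and> w \<in> Q.flag i \<and> w \<in> P.flag j}"
    by (force simp: le_iff_add)
  finally show ?thesis
    by (simp add: split_sum_def)
qed

text \<open>A shift of \<open>A\<close> moves the component with indices \<open>i\<close>, \<open>Suc j\<close> to the one with
  indices \<open>Suc i\<close>, \<open>j\<close>.\<close>

lemma matrix_module_A_split_sum:
  assumes module: "matrix_module {A} W"
  shows "matrix_module {A} (split_sum K W)"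
proof -
  have "A *v w \<in> split_sum K W"
    if ij_sum: "i + j = K" and w_mem: "w \<in> W" "w \<in> Q.flag i" "w \<in> P.flag j" for w i j
  proof -
    have w_split: "w \<in> split_sum K W"
      using split_sum_base[OF w_mem] ij_sum by simp
    show ?thesis
    proof (cases j)
      case 0
      then show ?thesis
        using w_mem(3) w_split subspace_split_sum by (simp add: P.A_on_flag_0 vec.subspace_scale)
    next
      case (Suc m)
      then obtain c where shift_mem: "A *v w - c *s w \<in> P.flag m"
        using P.A_shift_flag_Suc w_mem(3) by blast
      have "A *v w - c *s w \<in> W"
        using w_mem(1) module by (intro vec.subspace_diff vec.subspace_scale)
          (auto intro: matrix_moduleD matrix_module_subspace)
      moreover have "A *v w - c *s w \<in> Q.flag (Suc i)"
        using Q.B_flag[OF w_mem(2)] Q.flag_Suc_subset w_mem(2) Q.subspace_flag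
        by (blast intro: vec.subspace_diff vec.subspace_scale)
      ultimately have "A *v w - c *s w \<in> split_sum K W"
        using split_sum_base[of _ W "Suc i" m] shift_mem ij_sum Suc by simp
      then have "(A *v w - c *s w) + c *s w \<in> split_sum K W"
        using w_split subspace_split_sum by (blast intro: vec.subspace_add vec.subspace_scale)
      then show ?thesis by simp
    qed
  qed
  then have "A *v w \<in> split_sum K W" if "w \<in> split_sum K W" for w
    using that by (rule matrix_split_sum_mem[OF _ subspace_split_sum])
  then show ?thesis
    by (simp add: matrix_module_def subspace_split_sum)
qed

lemma matrix_module_split_sum:
  assumes module: "matrix_module {A, As} W"
  shows "matrix_module {A, As} (split_sum K W)"
proof -
  interpret swapped: tridiagonal_pair D As Es \<theta>s A E \<theta>
    by (rule swap)
  have "matrix_module {A} (split_sum K W)"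
    using matrix_module_antimono[OF module] by (intro matrix_module_A_split_sum) auto
  moreover have "matrix_module {As} (split_sum K W)"
    using matrix_module_antimono[OF module] swapped.matrix_module_A_split_sum[of W K]
    by (simp add: split_sum_swap)
  ultimately show ?thesis
    by (simp add: matrix_module_def)
qed

lemma irreducible_eq_split_sum:
  assumes irreducible: "irreducible_matrix_module {A, As} W"
  shows "split_sum (Max (Q.supp W) + Min (P.supp W)) W = W"
proof -
  let ?s = "Max (Q.supp W)" and ?t = "Min (P.supp W)"
  note module = irreducible_matrix_module_imp_module[OF irreducible]
  note subspace = matrix_module_subspace[OF module]
  obtain w where w_attains_Min: "w \<in> W" "?t \<le> D" "E ?t *v w \<noteq> 0"
    by (rule P.Min_supp_attained[OF subspace irreducible_matrix_module_nonzero[OF irreducible]])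
  have "E ?t *v w \<in> W"
    using P.matrix_module_E_mem[OF matrix_module_antimono[OF module]] w_attains_Min by blast
  moreover from this have "E ?t *v w \<in> Q.flag ?s"
    unfolding Q.flag_iff using Q.supp_bounds(2)[OF subspace] by (meson not_le)
  moreover have "E ?t *v w \<in> P.flag ?t"
    using w_attains_Min by (intro P.E_in_flag) auto
  ultimately have "E ?t *v w \<in> split_sum (?s + ?t) W"
    by (rule split_sum_base)
  with w_attains_Min(3) have "split_sum (?s + ?t) W \<noteq> {0}" by blast
  then show ?thesis
    by (intro irreducible_matrix_module_eqI[OF irreducible] matrix_module_split_sum[OF module]
        split_sum_subset[OF subspace])
qed

lemma split_sum_eq_imp_supp_bound:
  assumes nonzero_subspace: "vec.subspace W" "W \<noteq> {0}" and split_eq: "split_sum K W = W"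
  shows "Max (Q.supp W) + Min (P.supp W) \<le> K"
proof -
  let ?s = "Max (Q.supp W)"
  obtain w where w_attains_Max: "w \<in> W" "?s \<le> D" "Es ?s *v w \<noteq> 0"
    by (rule Q.Max_supp_attained[OF nonzero_subspace])
  obtain i j u where u_component: "i + j = K" "u \<in> W" "u \<in> Q.flag i" "u \<in> P.flag j" "Es ?s *v u \<noteq> 0"
    using matrix_split_sum_mem[where M = "Es ?s" and U = "{0}"] w_attains_Max split_eq
    by (metis singleton_iff vec.subspace_single_0)
  then obtain h where h_attained: "h \<le> D" "E h *v u \<noteq> 0"
    using P.E_zero_imp_zero by (metis vec.zero)
  have "?s \<le> i"
    using Q.flag_bound u_component w_attains_Max(2) by blast
  moreover have "Min (P.supp W) \<le> h"
    using P.supp_bounds(1)[OF nonzero_subspace(1) u_component(2) h_attained] .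
  moreover have "h \<le> j"
    using P.flag_bound u_component(4) h_attained by blast
  ultimately show ?thesis
    using u_component(1) by linarith
qed

lemma submodule_of_split_sum_UNIV:
  assumes module: "matrix_module {A, As} W" and subset: "W \<subseteq> split_sum K UNIV"
  shows "split_sum K W = W"
proof (rule subset_antisym)
  note subspace = matrix_module_subspace[OF module]
  show "split_sum K W \<subseteq> W"
    by (rule split_sum_subset[OF subspace])
  let ?R = "orthogonal_projection W"
  have A_modules: "matrix_module {A} W" "matrix_module {A} (W\<^sup>\<bottom>)"
    and As_modules: "matrix_module {As} W" "matrix_module {As} (W\<^sup>\<bottom>)"
    using matrix_module_antimono[OF module] self_adjoint_A self_adjoint_As
    by (auto intro!: matrix_module_orthogonal_comp)
  have projection_E: "?R *v (E j *v v) = E j *v (?R *v v)" if "j \<le> D" for j v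
    using that A_modules by (intro orthogonal_projection_commute P.matrix_module_E)
  have projection_Es: "?R *v (Es j *v v) = Es j *v (?R *v v)" if "j \<le> D" for j v
    using that As_modules by (intro orthogonal_projection_commute Q.matrix_module_E)
  have "?R *v v \<in> P.flag j" if "v \<in> P.flag j" for v j
    using that by (auto simp: P.flag_iff simp flip: projection_E)
  moreover have "?R *v v \<in> Q.flag j" if "v \<in> Q.flag j" for v j
    using that by (auto simp: Q.flag_iff simp flip: projection_Es)
  ultimately have "?R *v w \<in> split_sum K W"
    if "i + j = K" "w \<in> UNIV" "w \<in> Q.flag i" "w \<in> P.flag j" for i j w
    using that orthogonal_projection_mem[OF subspace] split_sum_base by blast
  then have "?R *v u \<in> split_sum K W" if "u \<in> split_sum K UNIV" for u
    using that by (rule matrix_split_sum_mem[OF _ subspace_split_sum])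
  then show "W \<subseteq> split_sum K W"
    using subset orthogonal_projection_id[OF subspace] by (metis subsetD subsetI)
qed

end

locale wide_tridiagonal_pair = tridiagonal_pair +
  assumes P_wide: "matrix_module {A, As} W \<Longrightarrow> W \<noteq> {0} \<Longrightarrow> D \<le> Min (P.supp W) + Max (P.supp W)"
    and Q_wide: "matrix_module {A, As} W \<Longrightarrow> W \<noteq> {0} \<Longrightarrow> D \<le> Min (Q.supp W) + Max (Q.supp W)"
begin

lemma diameter_le_Max_supp_plus_Min_supp:
  assumes irreducible: "irreducible_matrix_module {A, As} W"
  shows "D \<le> Max (Q.supp W) + Min (P.supp W)"
proof -
  interpret swapped: tridiagonal_pair D As Es \<theta>s A E \<theta>
    by (rule swap)
  note module = irreducible_matrix_module_imp_module[OF irreducible]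
    and nonzero = irreducible_matrix_module_nonzero[OF irreducible]
  have "Max (P.supp W) + Min (Q.supp W) \<le> Max (Q.supp W) + Min (P.supp W)"
    using irreducible_eq_split_sum[OF irreducible]
    by (intro swapped.split_sum_eq_imp_supp_bound matrix_module_subspace[OF module] nonzero)
      (simp add: split_sum_swap)
  with P_wide[OF module nonzero] Q_wide[OF module nonzero] show ?thesis by linarith
qed

lemma split_sum_eq_span_irreducible:
  "split_sum D UNIV =
     vec.span (\<Union>{W. irreducible_matrix_module {A, As} W \<and> Max (Q.supp W) + Min (P.supp W) = D})"
    (is "_ = vec.span (\<Union>?\<W>)")
proof (rule subset_antisym)
  have "matrix_module {A, As} (split_sum D UNIV)"
    by (rule matrix_module_split_sum) (simp add: matrix_module_def)
  then have "split_sum D UNIV =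
      vec.span (\<Union>{W. irreducible_matrix_module {A, As} W \<and> W \<subseteq> split_sum D UNIV})"
    using self_adjoint_A self_adjoint_As by (intro matrix_module_eq_span_irreducible) auto
  also have "\<dots> \<subseteq> vec.span (\<Union>?\<W>)"
  proof (intro vec.span_mono Union_mono Collect_mono impI conjI; elim conjE)
    fix W assume irreducible: "irreducible_matrix_module {A, As} W"
      and subset: "W \<subseteq> split_sum D UNIV"
    note module = irreducible_matrix_module_imp_module[OF irreducible]
    have "Max (Q.supp W) + Min (P.supp W) \<le> D"
      using submodule_of_split_sum_UNIV[OF module subset]
        irreducible_matrix_module_nonzero[OF irreducible]
      by (intro split_sum_eq_imp_supp_bound matrix_module_subspace[OF module])
    then show "Max (Q.supp W) + Min (P.supp W) = D"
      using diameter_le_Max_supp_plus_Min_supp[OF irreducible] by linarith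
  qed
  finally show "split_sum D UNIV \<subseteq> vec.span (\<Union>?\<W>)" .
next
  have "W \<subseteq> split_sum D UNIV" if "W \<in> ?\<W>" for W
    using that irreducible_eq_split_sum[of W] split_sum_mono[of W UNIV D] by auto
  then show "vec.span (\<Union>?\<W>) \<subseteq> split_sum D UNIV"
    by (intro vec.span_minimal subspace_split_sum) blast
qed

end

section \<open>Primitive idempotents of self-adjoint matrices\<close>

lemma matrix_module_eigenspace: "matrix_module {A} (eigenspace A c)"
  by (auto simp: matrix_module_def eigenspace_def vec.subspace_def matrix_vector_right_distrib
      vector_scalar_commute vec.scale_right_distrib mult.commute)

lemmas subspace_eigenspace = matrix_module_subspace[OF matrix_module_eigenspace]

lemma self_adjoint_span_eigenspaces:
  fixes A :: "complex^'n^'n"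
  assumes self_adjoint: "self_adjoint ((*v) A)"
  shows "vec.span (\<Union>c :: real. eigenspace A (of_real c)) = UNIV" (is "?U = _")
proof -
  have "matrix_module {A} ?U"
    using matrix_moduleD[OF matrix_module_eigenspace, of A A]
    by (intro matrix_module_span vec.span_base) blast
  then have perp_module: "matrix_module {A} (?U\<^sup>\<bottom>)"
    using self_adjoint by (intro matrix_module_orthogonal_comp) auto
  have "?U\<^sup>\<bottom> = {0}"
  proof (rule ccontr)
    assume nonzero: "?U\<^sup>\<bottom> \<noteq> {0}"
    have "subspace (?U\<^sup>\<bottom>)" "(*v) A ` (?U\<^sup>\<bottom>) \<subseteq> ?U\<^sup>\<bottom>"
      using perp_module by (auto intro: vec_subspace_imp_subspace simp: matrix_module_def)
    then obtain v c where eigenvector: "v \<in> ?U\<^sup>\<bottom>" "v \<noteq> 0" "A *v v = c *\<^sub>R v"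
      using self_adjoint_eigenvector_exists[OF matrix_vector_mul_linear self_adjoint _ _ nonzero]
      by blast
    then have "v \<in> ?U"
      by (intro vec.span_base) (auto simp: eigenspace_def scaleR_eq_of_real_smult)
    with eigenvector show False
      using orthogonal_comp_Int_zero by blast
  qed
  then show ?thesis
    by (metis orthogonal_comp_null orthogonal_comp_self vec.subspace_span vec_subspace_imp_subspace)
qed

lemma self_adjoint_matrix_eqI:
  fixes A :: "complex^'n^'n"
  assumes self_adjoint: "self_adjoint ((*v) A)"
    and eq_on_eigenspaces: "\<And>c v. v \<in> eigenspace A (of_real c) \<Longrightarrow> M *v v = N *v v"
  shows "M = N"
proof -
  have "M *v v = N *v v" for v
  proof (rule vec.module_hom_eq_on_span[where B = "\<Union>c :: real. eigenspace A (of_real c)"])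
    show "v \<in> vec.span (\<Union>c :: real. eigenspace A (of_real c))"
      by (simp add: self_adjoint_span_eigenspaces[OF self_adjoint])
  qed (use eq_on_eigenspaces in blast)+
  then show ?thesis
    by (simp add: matrix_eq)
qed

lemma self_adjoint_eigenvalue_real:
  fixes A :: "complex^'n^'n"
  assumes self_adjoint: "self_adjoint ((*v) A)" and eigenvector: "v \<in> eigenspace A \<mu>" "v \<noteq> 0"
  shows "\<mu> \<in> \<real>"
proof -
  have inner_smult_self: "(a *s v) \<bullet> v = Re a * (v \<bullet> v)" for a
    by (simp add: inner_vec_def inner_complex_def sum_distrib_left algebra_simps)
  have "(A *v v) \<bullet> (\<i> *s v) = v \<bullet> (A *v (\<i> *s v))"
    by (rule self_adjointD[OF self_adjoint])
  then have "Im \<mu> * (v \<bullet> v) = - Im \<mu> * (v \<bullet> v)"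
    using eigenvector(1)
    by (simp add: eigenspace_def vector_scalar_commute inner_smult_right inner_smult_self)
  with eigenvector(2) show ?thesis
    by (simp add: complex_is_Real_iff)
qed

lemma eigenspaces_orthogonal:
  fixes A :: "complex^'n^'n"
  assumes self_adjoint: "self_adjoint ((*v) A)"
    and eigenvectors: "u \<in> eigenspace A (of_real a)" "v \<in> eigenspace A (of_real b)" and "a \<noteq> b"
  shows "orthogonal u v"
proof -
  have "(A *v u) \<bullet> v = u \<bullet> (A *v v)"
    by (rule self_adjointD[OF self_adjoint])
  then have "a * (u \<bullet> v) = b * (u \<bullet> v)"
    using eigenvectors by (simp add: eigenspace_def flip: scaleR_eq_of_real_smult)
  with \<open>a \<noteq> b\<close> show ?thesis
    by (simp add: orthogonal_def)
qed

definition eigenprojection :: "complex^'n^'n \<Rightarrow> real \<Rightarrow> complex^'n^'n" where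
  "eigenprojection A c = orthogonal_projection (eigenspace A (of_real c))"

lemma eigenprojection_mem: "eigenprojection A c *v v \<in> eigenspace A (of_real c)"
  unfolding eigenprojection_def by (rule orthogonal_projection_mem[OF subspace_eigenspace])

lemma eigenprojection_on_eigenspace:
  assumes self_adjoint: "self_adjoint ((*v) A)" and v_mem: "v \<in> eigenspace A (of_real b)"
  shows "eigenprojection A c *v v = (if b = c then v else 0)"
proof (cases "b = c")
  case True
  with v_mem show ?thesis
    by (simp add: eigenprojection_def orthogonal_projection_id subspace_eigenspace)
next
  case False
  then have "v \<in> (eigenspace A (of_real c))\<^sup>\<bottom>"
    using eigenspaces_orthogonal[OF self_adjoint _ v_mem] by (auto simp: orthogonal_comp_def)
  with False show ?thesis
    by (simp add: eigenprojection_def orthogonal_projection_zero subspace_eigenspace)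
qed

lemma primitive_idempotent_eigenprojection:
  assumes self_adjoint: "self_adjoint ((*v) A)" and nonzero: "eigenspace A (of_real c) \<noteq> {0}"
  shows "primitive_idempotent A (eigenprojection A c)"
proof -
  let ?F = "eigenprojection A c"
  have identity: "?F *v v = v" if "v \<in> eigenspace A (of_real c)" for v
    using that by (simp add: eigenprojection_on_eigenspace[OF self_adjoint])
  then have "eigenspace A (of_real c) \<subseteq> range ((*v) ?F)"
    by (metis rangeI subsetI)
  then have "range ((*v) ?F) = eigenspace A (of_real c)"
    using eigenprojection_mem[of A c] by auto
  moreover have "?F *v v = 0" if other: "\<mu> \<noteq> of_real c" and v_mem: "v \<in> eigenspace A \<mu>" for \<mu> v
  proof (cases "v = 0")
    case False
    then obtain b where "\<mu> = of_real b"
      using self_adjoint_eigenvalue_real[OF self_adjoint v_mem] Reals_cases by metis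
    with other v_mem show ?thesis
      by (auto simp: eigenprojection_on_eigenspace[OF self_adjoint])
  qed simp
  ultimately show ?thesis
    unfolding primitive_idempotent_def using nonzero identity by blast
qed

lemma primitive_idempotentE:
  assumes self_adjoint: "self_adjoint ((*v) A)" and "primitive_idempotent A F"
  obtains c :: real where "eigenspace A (of_real c) \<noteq> {0}" "F = eigenprojection A c"
proof -
  from assms(2) obtain \<mu> where nonzero: "eigenspace A \<mu> \<noteq> {0}"
    and identity: "\<And>v. v \<in> eigenspace A \<mu> \<Longrightarrow> F *v v = v"
    and annihilates: "\<And>b v. b \<noteq> \<mu> \<Longrightarrow> v \<in> eigenspace A b \<Longrightarrow> F *v v = 0"
    unfolding primitive_idempotent_def by blast
  obtain u where "u \<in> eigenspace A \<mu>" "u \<noteq> 0"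
    using nonzero vec.subspace_0[OF subspace_eigenspace, of A \<mu>] by blast
  then obtain c where \<mu>_real: "\<mu> = of_real c"
    using self_adjoint_eigenvalue_real[OF self_adjoint] Reals_cases by metis
  have "F = eigenprojection A c"
    using self_adjoint
  proof (rule self_adjoint_matrix_eqI)
    show "F *v v = eigenprojection A c *v v" if "v \<in> eigenspace A (of_real b)" for b v
      using that identity annihilates[of "of_real b" v] \<mu>_real
      by (cases "b = c") (auto simp: eigenprojection_on_eigenspace[OF self_adjoint])
  qed
  with nonzero \<mu>_real that show ?thesis by blast
qed

lemma eigenprojection_inj:
  assumes self_adjoint: "self_adjoint ((*v) A)"
    and eigenvector: "v \<in> eigenspace A (of_real b)" "v \<noteq> 0"
    and "eigenprojection A b = eigenprojection A c"
  shows "b = c"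
  using assms(4) eigenvector(2) eigenprojection_on_eigenspace[OF self_adjoint eigenvector(1)]
  by metis

lemma sum_eigenprojections:
  fixes A :: "complex^'n^'n"
  assumes self_adjoint: "self_adjoint ((*v) A)" and "finite I" and inj: "inj_on \<theta> I"
    and eigenvalues: "\<And>c v. v \<in> eigenspace A (of_real c) \<Longrightarrow> v \<noteq> 0 \<Longrightarrow> c \<in> \<theta> ` I"
  shows "(\<Sum>i\<in>I. eigenprojection A (\<theta> i)) = mat 1"
  using self_adjoint
proof (rule self_adjoint_matrix_eqI)
  fix c v assume v_mem: "v \<in> eigenspace A (of_real c)"
  show "(\<Sum>i\<in>I. eigenprojection A (\<theta> i)) *v v = mat 1 *v v"
  proof (cases "v = 0")
    case False
    then obtain k where k_index: "k \<in> I" "c = \<theta> k"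
      using eigenvalues[OF v_mem] by auto
    then have "(\<Sum>i\<in>I. eigenprojection A (\<theta> i) *v v) = (\<Sum>i\<in>I. if i = k then v else 0)"
      using inj by (intro sum.cong)
        (auto simp: eigenprojection_on_eigenspace[OF self_adjoint v_mem] inj_on_def)
    with k_index \<open>finite I\<close> show ?thesis
      by (simp add: sum_matrix_vector_mult)
  qed simp
qed

lemma primitive_idempotents_spectral_decomposition:
  fixes A :: "complex^'n^'n"
  assumes self_adjoint: "self_adjoint ((*v) A)"
    and bij: "bij_betw E {..D} {F. primitive_idempotent A F}"
  obtains \<theta> where "spectral_decomposition D A E \<theta>"
proof -
  have "\<forall>i\<in>{..D}. \<exists>c. E i = eigenprojection A c"
    using bij primitive_idempotentE[OF self_adjoint] unfolding bij_betw_def by blast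
  then obtain \<theta> where E_eq: "\<And>i. i \<le> D \<Longrightarrow> E i = eigenprojection A (\<theta> i)"
    by (metis atMost_iff)
  have inj: "inj_on \<theta> {..D}"
    using bij E_eq by (auto simp: bij_betw_def inj_on_def)
  have eigenvalues: "c \<in> \<theta> ` {..D}" if eigenvector: "v \<in> eigenspace A (of_real c)" "v \<noteq> 0" for c v
  proof -
    have "primitive_idempotent A (eigenprojection A c)"
      using eigenvector by (intro primitive_idempotent_eigenprojection[OF self_adjoint]) auto
    then obtain k where "k \<le> D" "eigenprojection A c = eigenprojection A (\<theta> k)"
      using bij E_eq by (auto simp: bij_betw_def image_def set_eq_iff)
    then show ?thesis
      using eigenprojection_inj[OF self_adjoint eigenvector] by blast
  qed
  have "spectral_decomposition D A E \<theta>"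
  proof
    show "A *v (E i *v v) = of_real (\<theta> i) *s (E i *v v)" if "i \<le> D" for i v
      using eigenprojection_mem[of A "\<theta> i" v] that by (simp add: E_eq eigenspace_def)
    show "E i *v (E j *v v) = (if i = j then E j *v v else 0)" if "i \<le> D" "j \<le> D" for i j v
      using that inj
      by (auto simp: E_eq inj_on_def
          eigenprojection_on_eigenspace[OF self_adjoint eigenprojection_mem])
    have "(\<Sum>i\<le>D. E i) = mat 1"
      using sum_eigenprojections[OF self_adjoint finite_atMost inj eigenvalues] by (simp add: E_eq)
    then show "(\<Sum>i\<le>D. E i *v v) = v" for v
      by (simp flip: sum_matrix_vector_mult)
  qed (rule inj)
  then show ?thesis by (rule that)
qed

section \<open>Three-term recurrences\<close>

lemma generated_subalgebra: "matrix_subalgebra (matrix_subalgebra hull S)"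
  by (rule hull_in) (fastforce simp: matrix_subalgebra_def)

lemma matrix_subalgebra_sum:
  assumes "matrix_subalgebra R" "\<And>i. i \<in> I \<Longrightarrow> f i \<in> R"
  shows "(\<Sum>i\<in>I. f i) \<in> R"
proof -
  have "matrix_scale 0 (mat 1) \<in> R"
    using assms(1) by (simp add: matrix_subalgebra_def)
  then have "0 \<in> R"
    by (simp add: matrix_scale_def zero_vec_def)
  with assms show ?thesis
    by (induction I rule: infinite_finite_induct) (auto simp: matrix_subalgebra_def)
qed

lemma matrix_subalgebra_linear_combination:
  "matrix_subalgebra R \<Longrightarrow> (\<And>i. i \<in> I \<Longrightarrow> M i \<in> R) \<Longrightarrow> (\<Sum>i\<in>I. matrix_scale (c i) (M i)) \<in> R"
  by (rule matrix_subalgebra_sum) (auto simp: matrix_subalgebra_def)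

locale three_term_recurrence =
  fixes D :: nat and B :: "complex^'n^'n" and M :: "nat \<Rightarrow> complex^'n^'n"
    and c :: "nat \<Rightarrow> nat \<Rightarrow> complex"
  assumes recurrence: "j \<le> D \<Longrightarrow> B ** M j = (\<Sum>h\<le>D. matrix_scale (c h j) (M h))"
    and far: "h \<le> D \<Longrightarrow> j \<le> D \<Longrightarrow> h > Suc j \<or> j > Suc h \<Longrightarrow> c h j = 0"
    and up: "j < D \<Longrightarrow> c (Suc j) j \<noteq> 0"
    and down: "j < D \<Longrightarrow> c j (Suc j) \<noteq> 0"
    and M_0: "M 0 = mat 1"
begin

lemma M_Suc:
  assumes "j < D"
  shows "M (Suc j) =
    matrix_scale (1 / c (Suc j) j)
      (B ** M j + matrix_scale (- 1) (\<Sum>h\<le>j. matrix_scale (c h j) (M h)))"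
proof -
  have "B ** M j = (\<Sum>h\<le>Suc j. matrix_scale (c h j) (M h))"
    unfolding recurrence[OF less_imp_le[OF assms]] using assms far
    by (intro sum.mono_neutral_right) (auto simp: matrix_scale_def vec_eq_iff)
  then show ?thesis
    using up[OF assms] by (simp add: matrix_scale_def vec_eq_iff)
qed

lemma M_in_generated_subalgebra: "j \<le> D \<Longrightarrow> M j \<in> matrix_subalgebra hull {B}"
proof (induction j rule: less_induct)
  case (less j)
  note closed = iffD1[OF matrix_subalgebra_def generated_subalgebra[of "{B}"]]
  show ?case
  proof (cases j)
    case 0
    then show ?thesis using closed by (simp add: M_0)
  next
    case (Suc k)
    have "(\<Sum>h\<le>k. matrix_scale (c h k) (M h)) \<in> matrix_subalgebra hull {B}"
      using less Suc by (intro matrix_subalgebra_linear_combination generated_subalgebra) auto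
    moreover have "B ** M k \<in> matrix_subalgebra hull {B}"
      using closed less Suc hull_inc[of B "{B}" matrix_subalgebra] by auto
    ultimately show ?thesis
      using closed M_Suc[of k] less.prems Suc by simp
  qed
qed

lemma matrix_module_M:
  assumes "matrix_module {B} W" "j \<le> D"
  shows "matrix_module {M j} W"
  using assms(1) M_in_generated_subalgebra[OF assms(2)]
  by (auto simp flip: matrix_module_generated[of "{B}"] intro: matrix_module_antimono)

lemma M_annihilates_pred:
  assumes j_less: "j < D" and M_zero: "\<And>h. h \<le> D \<Longrightarrow> j < h \<Longrightarrow> M h *v v = 0"
  shows "M j *v v = 0"
proof -
  have "0 = B *v (M (Suc j) *v v)"
    using j_less M_zero[of "Suc j"] by simp
  also have "\<dots> = (\<Sum>h\<le>D. c h (Suc j) *s (M h *v v))"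
    using j_less
    by (simp add: matrix_vector_mul_assoc recurrence sum_matrix_vector_mult
        matrix_scale_vector_mult)
  also have "\<dots> = (\<Sum>h\<le>D. if h = j then c j (Suc j) *s (M j *v v) else 0)"
  proof (intro sum.cong refl)
    fix h assume "h \<in> {..D}"
    then show "c h (Suc j) *s (M h *v v) = (if h = j then c j (Suc j) *s (M j *v v) else 0)"
      using j_less M_zero[of h] far[of h "Suc j"] by (cases h j rule: linorder_cases) auto
  qed
  finally show ?thesis
    using j_less down[of j] by simp
qed

lemma M_D_inj:
  assumes "M D *v v = 0"
  shows "v = 0"
proof -
  have "\<forall>h\<le>D. j \<le> h \<longrightarrow> M h *v v = 0" if "j \<le> D" for j
    using that
  proof (induction rule: inc_induct)
    case base
    then show ?case using assms by auto
  next
    case (step j)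
    have "M j *v v = 0"
    proof (rule M_annihilates_pred)
      show "M h *v v = 0" if "h \<le> D" "j < h" for h
        using step.IH that by (simp add: Suc_le_eq)
    qed (rule step.hyps)
    with step.IH show ?case
      by (metis Suc_leI le_neq_implies_less)
  qed
  from this[of 0] have "M 0 *v v = 0" by blast
  then show ?thesis
    by (simp add: M_0)
qed

end

section \<open>Diagonal matrices and traces\<close>

definition diagonal_matrix :: "('n \<Rightarrow> complex) \<Rightarrow> complex^'n^'n" where
  "diagonal_matrix f = (\<chi> y z. if y = z then f y else 0)"

lemma diagonal_matrix_vector_nth: "(diagonal_matrix f *v v) $ y = f y * v $ y"
  by (simp add: diagonal_matrix_def matrix_vector_mult_def if_distrib[of "\<lambda>t. t * _"] cong: if_cong)

lemma diagonal_matrix_mult_nth: "(diagonal_matrix f ** M) $ y $ z = f y * M $ y $ z"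
  by (simp add: diagonal_matrix_def matrix_matrix_mult_def if_distrib[of "\<lambda>t. t * _"] cong: if_cong)

lemma transpose_diagonal_matrix: "transpose (diagonal_matrix f) = diagonal_matrix f"
  by (auto simp: vec_eq_iff transpose_def diagonal_matrix_def)

lemma trace_diagonal_hadamard:
  "trace (M ** diagonal_matrix f ** N ** diagonal_matrix f) =
     (\<Sum>y\<in>UNIV. \<Sum>z\<in>UNIV. f y * hadamard (transpose M) N $ y $ z * f z)"
proof -
  have "trace (M ** diagonal_matrix f ** N ** diagonal_matrix f) =
      trace ((diagonal_matrix f ** N) ** (diagonal_matrix f ** M))"
    using trace_mul_sym[of M "diagonal_matrix f ** N ** diagonal_matrix f"]
    by (simp add: matrix_mul_assoc)
  also have "\<dots> = (\<Sum>y\<in>UNIV. \<Sum>z\<in>UNIV. f y * hadamard (transpose M) N $ y $ z * f z)"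
    unfolding trace_def matrix_matrix_mult_def[of "diagonal_matrix f ** N"]
    by (simp add: diagonal_matrix_mult_nth hadamard_def transpose_def mult_ac)
  finally show ?thesis .
qed

lemma trace_mult_transpose_eq_zero:
  fixes N :: "complex^'n^'n"
  assumes real: "\<And>y z. N $ y $ z \<in> \<real>" and trace: "trace (N ** transpose N) = 0"
  shows "N = 0"
proof -
  have square: "N $ y $ z * N $ y $ z = of_real ((Re (N $ y $ z))\<^sup>2)" for y z
    using real[of y z] by (metis of_real_Re of_real_mult power2_eq_square)
  have "of_real (\<Sum>y\<in>UNIV. \<Sum>z\<in>UNIV. (Re (N $ y $ z))\<^sup>2) = trace (N ** transpose N)"
    unfolding trace_def matrix_matrix_mult_def by (simp add: transpose_def square)
  then have "(\<Sum>y\<in>UNIV. \<Sum>z\<in>UNIV. (Re (N $ y $ z))\<^sup>2) = 0"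
    unfolding trace using of_real_eq_0_iff by blast
  then have "Re (N $ y $ z) = 0" for y z
    by (simp add: sum_nonneg_eq_0_iff sum_nonneg)
  then show ?thesis
    using real by (simp add: vec_eq_iff complex_eq_iff complex_is_Real_iff)
qed

lemma self_adjoint_real_symmetric:
  fixes M :: "complex^'n^'n"
  assumes real: "\<And>y z. M $ y $ z \<in> \<real>" and symmetric: "transpose M = M"
  shows "self_adjoint ((*v) M)"
  unfolding self_adjoint_def
proof (intro allI)
  fix u v :: "complex^'n"
  define m where "m y z = Re (M $ y $ z)" for y z
  have M_nth: "M $ y $ z = of_real (m y z)" for y z
    using real by (simp add: m_def of_real_Re)
  have m_symmetric: "m y z = m z y" for y z
    using arg_cong[OF symmetric, of "\<lambda>N. Re (N $ z $ y)"] by (simp add: m_def transpose_def)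
  have "(M *v u) \<bullet> v = (\<Sum>y\<in>UNIV. \<Sum>z\<in>UNIV. m y z * (u $ z \<bullet> v $ y))"
    by (simp add: inner_vec_def matrix_vector_mult_def M_nth inner_sum_left
        flip: scaleR_conv_of_real)
  also have "\<dots> = (\<Sum>z\<in>UNIV. \<Sum>y\<in>UNIV. m z y * (u $ z \<bullet> v $ y))"
    by (subst sum.swap) (simp add: m_symmetric)
  also have "\<dots> = u \<bullet> (M *v v)"
    by (simp add: inner_vec_def matrix_vector_mult_def M_nth inner_sum_right
        flip: scaleR_conv_of_real)
  finally show "(M *v u) \<bullet> v = u \<bullet> (M *v v)" .
qed

section \<open>Distance-regular graphs\<close>

locale distance_regular_graph =
  fixes adj :: "'v::finite \<Rightarrow> 'v \<Rightarrow> bool" and D :: nat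
  assumes D_def: "D = graph_diameter adj" and D_ge_1: "D \<ge> 1"
    and distance_regular: "distance_regular adj"
begin

abbreviation \<delta> :: "'v \<Rightarrow> 'v \<Rightarrow> nat" where
  "\<delta> \<equiv> graph_dist adj"

lemma adj_sym: "adj y z \<Longrightarrow> adj z y"
  using distance_regular by (auto simp: distance_regular_def simple_graph_def symp_def)

lemma adj_irrefl: "\<not> adj y y"
  using distance_regular by (auto simp: distance_regular_def simple_graph_def irreflp_def)

lemma relpowp_dist: "(adj ^^ \<delta> y z) y z"
proof -
  have "adj\<^sup>*\<^sup>* y z"
    using distance_regular by (simp add: distance_regular_def connected_graph_def)
  then have "\<exists>n. (adj ^^ n) y z"
    by (simp add: rtranclp_power)
  then show ?thesis
    unfolding graph_dist_def by (rule LeastI_ex)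
qed

lemma dist_le: "(adj ^^ n) y z \<Longrightarrow> \<delta> y z \<le> n"
  unfolding graph_dist_def by (rule Least_le)

lemma dist_triangle: "\<delta> y z \<le> \<delta> y w + \<delta> w z"
  by (rule dist_le) (rule relpowp_trans[OF relpowp_dist relpowp_dist])

lemma dist_eq_0 [simp]: "\<delta> y z = 0 \<longleftrightarrow> y = z"
  using relpowp_dist[of y z] dist_le[of 0 y z] by auto

lemma dist_self [simp]: "\<delta> y y = 0"
  by simp

lemma dist_sym: "\<delta> y z = \<delta> z y"
proof -
  have "(adj ^^ n) z y" if "(adj ^^ n) y z" for n y z
    using that
  proof (induction n arbitrary: z)
    case (Suc n)
    obtain w where "(adj ^^ n) y w" "adj w z"
      using Suc.prems by (rule relpowp_Suc_E)
    then have "adj z w" "(adj ^^ n) w y"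
      using Suc.IH adj_sym by blast+
    then show ?case
      by (rule relpowp_Suc_I2)
  qed auto
  then show ?thesis
    using dist_le relpowp_dist by (meson le_antisym)
qed

lemma dist_eq_1: "\<delta> y z = 1 \<longleftrightarrow> adj y z"
proof
  assume "adj y z"
  then have "\<delta> y z \<le> 1" "\<delta> y z \<noteq> 0"
    using dist_le[of 1 y z] adj_irrefl by auto
  then show "\<delta> y z = 1" by linarith
qed (use relpowp_dist[of y z] in auto)

lemma dist_SucE:
  assumes "\<delta> y z = Suc n"
  obtains w where "\<delta> y w = 1" "\<delta> w z = n"
proof -
  obtain w where w_path: "adj y w" "(adj ^^ n) w z"
    using relpowp_dist[of y z] unfolding assms by (rule relpowp_Suc_E2)
  moreover have "\<delta> w z \<le> n" "Suc n \<le> 1 + \<delta> w z"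
    using dist_le[OF w_path(2)] dist_triangle[of y z w] assms w_path(1)
    by (auto simp flip: dist_eq_1)
  ultimately show ?thesis
    using that[of w] by (simp add: dist_eq_1 del: One_nat_def)
qed

lemma finite_distances: "finite {\<delta> y z | y z. True}"
  by (rule finite_subset[of _ "(\<lambda>(y, z). \<delta> y z) ` UNIV"]) auto

lemma dist_le_D: "\<delta> y z \<le> D"
  unfolding D_def graph_diameter_def using finite_distances by (intro Max_ge) auto

lemma dist_attained:
  assumes "i \<le> D"
  obtains y z where "\<delta> y z = i"
proof -
  have "\<exists>y z. \<delta> y z = i"
    using assms
  proof (induction rule: inc_induct)
    case base
    have "Max {\<delta> y z | y z. True} \<in> {\<delta> y z | y z. True}"
      using finite_distances by (intro Max_in) auto
    then show ?case
      unfolding D_def graph_diameter_def by fastforce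
  next
    case (step n)
    then show ?case by (meson dist_SucE)
  qed
  with that show ?thesis by blast
qed

definition intersection_number :: "nat \<Rightarrow> nat \<Rightarrow> nat \<Rightarrow> nat" where
  "intersection_number h i j =
     (SOME q. \<forall>y z. \<delta> y z = h \<longrightarrow> card {w. \<delta> y w = i \<and> \<delta> z w = j} = q)"

lemma card_eq_intersection_number:
  assumes "i \<le> D" "j \<le> D"
  shows "card {w. \<delta> y w = i \<and> \<delta> z w = j} = intersection_number (\<delta> y z) i j"
proof -
  have "\<exists>q. \<forall>y' z'. \<delta> y' z' = \<delta> y z \<longrightarrow> card {w. \<delta> y' w = i \<and> \<delta> z' w = j} = q"
    using distance_regular assms dist_le_D[of y z] unfolding distance_regular_def D_def by blast
  from someI_ex[OF this] show ?thesis
    unfolding intersection_number_def by blast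
qed

lemma intersection_number_eq_0_iff:
  assumes "i \<le> D" "j \<le> D"
  shows "intersection_number (\<delta> y z) i j = 0 \<longleftrightarrow> (\<forall>w. \<not> (\<delta> y w = i \<and> \<delta> z w = j))"
  unfolding card_eq_intersection_number[OF assms, symmetric] by auto

lemma dist_attained_from:
  assumes "i \<le> D"
  obtains z where "\<delta> y z = i"
proof -
  obtain u v where "\<delta> u v = i"
    using assms by (rule dist_attained)
  then have "intersection_number (\<delta> y y) i i \<noteq> 0"
    using intersection_number_eq_0_iff[OF assms assms, of u u] by auto
  with that show ?thesis
    unfolding intersection_number_eq_0_iff[OF assms assms] by blast
qed

definition distance_matrix :: "nat \<Rightarrow> complex^'v^'v" where
  "distance_matrix j = (\<chi> y z. if \<delta> y z = j then 1 else 0)"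

abbreviation A :: "complex^'v^'v" where
  "A \<equiv> adjacency_matrix adj"

lemma A_eq_distance_matrix: "A = distance_matrix 1"
  by (simp add: adjacency_matrix_def distance_matrix_def dist_eq_1 del: One_nat_def)

lemma distance_matrix_0: "distance_matrix 0 = mat 1"
  by (simp add: distance_matrix_def mat_def)

lemma A_mult_distance_matrix_nth:
  assumes "j \<le> D"
  shows "(A ** distance_matrix j) $ y $ z = of_nat (intersection_number (\<delta> y z) 1 j)"
proof -
  have "(A ** distance_matrix j) $ y $ z = (\<Sum>w\<in>UNIV. if \<delta> y w = 1 \<and> \<delta> z w = j then 1 else 0)"
    unfolding A_eq_distance_matrix matrix_matrix_mult_def
    by (auto simp: distance_matrix_def dist_sym intro!: sum.cong)
  also have "\<dots> = of_nat (card {w. \<delta> y w = 1 \<and> \<delta> z w = j})"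
    by (simp flip: sum.inter_filter)
  finally show ?thesis
    using card_eq_intersection_number[OF D_ge_1 assms] by simp
qed

lemma matrix_eq_sum_distance_matrices:
  assumes "\<And>y z. M $ y $ z = f (\<delta> y z)"
  shows "M = (\<Sum>h\<le>D. matrix_scale (f h) (distance_matrix h))"
  using dist_le_D assms
  by (simp add: vec_eq_iff matrix_scale_def distance_matrix_def if_distrib cong: if_cong)

sublocale distance: three_term_recurrence D A distance_matrix
    "\<lambda>h j. of_nat (intersection_number h 1 j)"
proof
  show "A ** distance_matrix j =
      (\<Sum>h\<le>D. matrix_scale (of_nat (intersection_number h 1 j)) (distance_matrix h))"
    if "j \<le> D" for j
    using that by (intro matrix_eq_sum_distance_matrices A_mult_distance_matrix_nth)
  show "of_nat (intersection_number h 1 j) = (0::complex)"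
    if far: "h \<le> D" "j \<le> D" "h > Suc j \<or> j > Suc h" for h j
  proof -
    obtain y z where dist_yz: "\<delta> y z = h"
      using far(1) by (rule dist_attained)
    have "\<not> (\<delta> y w = 1 \<and> \<delta> z w = j)" for w
      using dist_triangle[of y z w] dist_triangle[of z w y] dist_sym[of w z] dist_sym[of z y]
        dist_yz far(3) by auto
    then show ?thesis
      using intersection_number_eq_0_iff[OF D_ge_1 far(2), of y z] dist_yz by simp
  qed
  fix j assume j_less: "j < D"
  then obtain y z where dist_yz: "\<delta> y z = Suc j"
    using dist_attained[of "Suc j"] by auto
  then obtain w where dist_w: "\<delta> y w = 1" "\<delta> w z = j"
    by (rule dist_SucE)
  show "of_nat (intersection_number (Suc j) 1 j) \<noteq> (0::complex)"
    using intersection_number_eq_0_iff[OF D_ge_1, of j y z] dist_w dist_yz j_less dist_sym[of z w]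
    by auto
  show "of_nat (intersection_number j 1 (Suc j)) \<noteq> (0::complex)"
    using intersection_number_eq_0_iff[OF D_ge_1, of "Suc j" w z] dist_w dist_yz j_less
      dist_sym[of z y] dist_sym[of w y]
    by auto
qed (rule distance_matrix_0)

lemma distance_function_matrix_in_Bose_Mesner:
  assumes "\<And>y z. M $ y $ z = f (\<delta> y z)"
  shows "M \<in> matrix_subalgebra hull {A}"
  unfolding matrix_eq_sum_distance_matrices[of M f, OF assms]
  by (intro matrix_subalgebra_linear_combination generated_subalgebra
      distance.M_in_generated_subalgebra) simp

definition real_Bose_Mesner :: "(complex^'v^'v) set" where
  "real_Bose_Mesner = span (distance_matrix ` {..D})"

lemma real_Bose_Mesner_nth:
  assumes "M \<in> real_Bose_Mesner"
  obtains f where "\<And>y z. M $ y $ z = of_real (f (\<delta> y z))"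
proof -
  have "\<exists>f. \<forall>y z. M $ y $ z = of_real (f (\<delta> y z))"
    using assms unfolding real_Bose_Mesner_def
  proof (induction rule: span_induct_alt)
    case base
    show ?case by (intro exI[of _ "\<lambda>_. 0"]) simp
  next
    case (step c M N)
    then obtain j f where "M = distance_matrix j" "\<forall>y z. N $ y $ z = of_real (f (\<delta> y z))"
      by auto
    then show ?case
      by (intro exI[of _ "\<lambda>d. c * (if d = j then 1 else 0) + f d"])
        (simp add: distance_matrix_def scaleR_conv_of_real[where 'a = complex])
  qed
  with that show ?thesis by blast
qed

lemma mat_1_in_real_Bose_Mesner: "mat 1 \<in> real_Bose_Mesner"
  unfolding real_Bose_Mesner_def distance_matrix_0[symmetric] by (rule span_base) simp

lemma A_mult_in_real_Bose_Mesner: "(**) A ` real_Bose_Mesner \<subseteq> real_Bose_Mesner"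
proof -
  have "A ** distance_matrix j \<in> real_Bose_Mesner" if "j \<le> D" for j
  proof -
    have "A ** distance_matrix j = (\<Sum>h\<le>D. real (intersection_number h 1 j) *\<^sub>R distance_matrix h)"
      using distance.recurrence[OF that] by (simp add: scaleR_eq_matrix_scale)
    also have "\<dots> \<in> real_Bose_Mesner"
      unfolding real_Bose_Mesner_def by (intro span_sum span_scale span_base) auto
    finally show ?thesis .
  qed
  then have "span ((**) A ` distance_matrix ` {..D}) \<subseteq> real_Bose_Mesner"
    unfolding real_Bose_Mesner_def by (intro span_minimal subspace_span) auto
  then show ?thesis
    by (simp add: real_Bose_Mesner_def linear_span_image[OF linear_matrix_mult])
qed

lemma self_adjoint_A: "self_adjoint ((*v) A)"
  by (rule self_adjoint_real_symmetric)
    (auto simp: adjacency_matrix_def transpose_def vec_eq_iff adj_sym)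

end

section \<open>Q-polynomial graphs\<close>

locale Q_polynomial_graph =
  distance_regular_graph adj D + spectral_decomposition D "adjacency_matrix adj" E \<theta>
  for adj :: "'v::finite \<Rightarrow> 'v \<Rightarrow> bool" and D E \<theta> +
  fixes x :: 'v
  assumes E_0: "E 0 = matrix_scale (1 / of_nat CARD('v)) (\<chi> y z. 1)"
    and Q_polynomial: "Q_polynomial D E"
begin

lemma E_mult_E: "i \<le> D \<Longrightarrow> j \<le> D \<Longrightarrow> E i ** E j = (if i = j then E j else 0)"
  by (simp add: matrix_eq E_E flip: matrix_vector_mul_assoc)

lemma E_in_real_Bose_Mesner:
  assumes i_le: "i \<le> D"
  shows "E i \<in> real_Bose_Mesner"
proof (rule eigencomponent_in_invariant_subspace[OF
    _ linear_matrix_mult _ A_mult_in_real_Bose_Mesner inj_\<theta>])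
  show "A ** E i = \<theta> i *\<^sub>R E i" if "i \<in> {..D}" for i
    using that by (simp add: matrix_eq A_E scaleR_eq_matrix_scale matrix_scale_vector_mult
        flip: matrix_vector_mul_assoc)
  have "(\<Sum>i\<le>D. E i) = mat 1"
    by (simp add: matrix_eq sum_matrix_vector_mult sum_E)
  then show "(\<Sum>i\<le>D. E i) \<in> real_Bose_Mesner"
    by (simp add: mat_1_in_real_Bose_Mesner)
qed (use i_le in \<open>simp_all add: real_Bose_Mesner_def\<close>)

lemma E_nth:
  assumes "i \<le> D"
  obtains f where "\<And>y z. E i $ y $ z = of_real (f (\<delta> y z))"
  using real_Bose_Mesner_nth[OF E_in_real_Bose_Mesner[OF assms]] by blast

lemma E_sym: "i \<le> D \<Longrightarrow> E i $ y $ z = E i $ z $ y"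
  by (metis E_nth dist_sym)

lemma transpose_E: "i \<le> D \<Longrightarrow> transpose (E i) = E i"
  by (simp add: vec_eq_iff transpose_def E_sym)

lemma E_real: "i \<le> D \<Longrightarrow> E i $ y $ z \<in> \<real>"
  by (metis E_nth Reals_of_real)

lemma hadamard_krein:
  assumes "i \<le> D" "j \<le> D"
  shows "hadamard (E i) (E j) =
    matrix_scale (1 / of_nat CARD('v)) (\<Sum>l\<le>D. matrix_scale (krein D E l i j) (E l))"
proof -
  obtain f g where "\<And>y z. E i $ y $ z = of_real (f (\<delta> y z))"
    "\<And>y z. E j $ y $ z = of_real (g (\<delta> y z))"
    using E_nth assms by metis
  then have "matrix_scale (of_nat CARD('v)) (hadamard (E i) (E j)) \<in> matrix_subalgebra hull {A}"
    by (intro distance_function_matrix_in_Bose_Mesner[where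
          f = "\<lambda>d. of_nat CARD('v) * (of_real (f d) * of_real (g d))"])
      (simp add: matrix_scale_def hadamard_def)
  then obtain c where expansion:
    "matrix_scale (of_nat CARD('v)) (hadamard (E i) (E j)) = (\<Sum>l\<le>D. matrix_scale (c l) (E l))"
    by (rule generated_subalgebra_expansion)
  have "hadamard (E i) (E j) =
      matrix_scale (1 / of_nat CARD('v)) (matrix_scale (of_nat CARD('v)) (hadamard (E i) (E j)))"
    by (simp add: matrix_scale_def vec_eq_iff)
  then have "\<exists>q. hadamard (E i) (E j) =
      matrix_scale (1 / of_nat CARD('v)) (\<Sum>l\<le>D. matrix_scale (q l) (E l))"
    unfolding expansion by (rule exI[of _ c])
  from someI_ex[OF this] show ?thesis
    unfolding krein_def .
qed

lemma hadamard_mult_E: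
  assumes "i \<le> D" "j \<le> D" "k \<le> D"
  shows "hadamard (E i) (E j) ** E k = matrix_scale (krein D E k i j / of_nat CARD('v)) (E k)"
proof -
  have "(\<Sum>l\<le>D. matrix_scale (krein D E l i j) (E l) *v (E k *v v)) =
      krein D E k i j *s (E k *v v)" for v
  proof -
    have "(\<Sum>l\<le>D. matrix_scale (krein D E l i j) (E l) *v (E k *v v)) =
        (\<Sum>l\<le>D. if l = k then krein D E k i j *s (E k *v v) else 0)"
      using assms(3) by (intro sum.cong) (auto simp: matrix_scale_vector_mult E_E)
    then show ?thesis
      using assms(3) by simp
  qed
  then show ?thesis
    by (simp add: matrix_eq hadamard_krein[OF assms(1,2)] matrix_scale_vector_mult
        sum_matrix_vector_mult flip: matrix_vector_mul_assoc)
qed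

definition dual_distance_matrix :: "nat \<Rightarrow> complex^'v^'v" where
  "dual_distance_matrix k = diagonal_matrix (\<lambda>y. of_nat CARD('v) * E k $ x $ y)"

abbreviation As :: "complex^'v^'v" where
  "As \<equiv> dual_adjacency_matrix E x"

abbreviation Es :: "nat \<Rightarrow> complex^'v^'v" where
  "Es \<equiv> dual_idempotent adj x"

lemma As_eq_dual_distance_matrix: "As = dual_distance_matrix 1"
  by (simp add: dual_adjacency_matrix_def dual_distance_matrix_def diagonal_matrix_def
      del: One_nat_def)

lemma dual_distance_matrix_vector_nth:
  "(dual_distance_matrix k *v v) $ y = of_nat CARD('v) * E k $ x $ y * v $ y"
  by (simp add: dual_distance_matrix_def diagonal_matrix_vector_nth)

lemma Es_vector_nth: "(Es i *v v) $ y = (if \<delta> x y = i then v $ y else 0)"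
proof -
  have "Es i = diagonal_matrix (\<lambda>y. if \<delta> x y = i then 1 else 0)"
    by (simp add: dual_idempotent_def diagonal_matrix_def vec_eq_iff)
  then show ?thesis
    by (simp add: diagonal_matrix_vector_nth)
qed

lemma As_mult_dual_distance_matrix:
  assumes "j \<le> D"
  shows "As ** dual_distance_matrix j =
    (\<Sum>h\<le>D. matrix_scale (krein D E h 1 j) (dual_distance_matrix h))"
proof -
  let ?n = "of_nat CARD('v) :: complex"
  have "?n * E 1 $ x $ y * (?n * E j $ x $ y) = (\<Sum>h\<le>D. krein D E h 1 j * (?n * E h $ x $ y))" for y
  proof -
    have "?n * E 1 $ x $ y * (?n * E j $ x $ y) = ?n * ?n * hadamard (E 1) (E j) $ x $ y"
      by (simp add: hadamard_def)
    also have "\<dots> = ?n * (\<Sum>h\<le>D. krein D E h 1 j * E h $ x $ y)"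
      unfolding hadamard_krein[OF D_ge_1 assms] by (simp add: matrix_scale_def)
    finally show ?thesis by (simp add: sum_distrib_left mult_ac)
  qed
  then show ?thesis
    by (simp add: matrix_eq vec_eq_iff As_eq_dual_distance_matrix sum_matrix_vector_mult
        matrix_scale_vector_mult dual_distance_matrix_vector_nth mult.assoc[symmetric]
        sum_distrib_right
        del: One_nat_def flip: matrix_vector_mul_assoc)
qed

lemma krein_eq_0:
  "h \<le> D \<Longrightarrow> i \<le> D \<Longrightarrow> j \<le> D \<Longrightarrow> h > i + j \<or> i > h + j \<or> j > h + i \<Longrightarrow> krein D E h i j = 0"
  using Q_polynomial unfolding Q_polynomial_def by blast

lemma krein_neq_0:
  "h \<le> D \<Longrightarrow> i \<le> D \<Longrightarrow> j \<le> D \<Longrightarrow> h = i + j \<or> i = h + j \<or> j = h + i \<Longrightarrow> krein D E h i j \<noteq> 0"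
  using Q_polynomial unfolding Q_polynomial_def by blast

sublocale dual_distance: three_term_recurrence D As dual_distance_matrix "\<lambda>h j. krein D E h 1 j"
proof
  show "As ** dual_distance_matrix j =
      (\<Sum>h\<le>D. matrix_scale (krein D E h 1 j) (dual_distance_matrix h))"
    if "j \<le> D" for j
    using that by (rule As_mult_dual_distance_matrix)
  show "krein D E h 1 j = 0" if "h \<le> D" "j \<le> D" "h > Suc j \<or> j > Suc h" for h j
    using that D_ge_1 by (intro krein_eq_0) auto
  show "krein D E (Suc j) 1 j \<noteq> 0" "krein D E j 1 (Suc j) \<noteq> 0" if "j < D" for j
    using that D_ge_1 krein_neq_0[of "Suc j" 1 j] krein_neq_0[of j 1 "Suc j"] by simp_all
  show "dual_distance_matrix 0 = mat 1"
    by (simp add: vec_eq_iff dual_distance_matrix_def diagonal_matrix_def mat_def E_0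
        matrix_scale_def)
qed

text \<open>The trace is the squared Frobenius norm of $E_h A^*_k E_j$.\<close>

lemma trace_E_dual_distance_matrix:
  assumes "h \<le> D" "j \<le> D" "k \<le> D"
  shows "trace (E h ** dual_distance_matrix k ** E j ** dual_distance_matrix k) =
    of_nat CARD('v) * krein D E k h j * E k $ x $ x"
proof -
  let ?n = "of_nat CARD('v) :: complex"
  have "trace (E h ** dual_distance_matrix k ** E j ** dual_distance_matrix k) =
      (\<Sum>y\<in>UNIV. \<Sum>z\<in>UNIV. ?n * E k $ x $ y * hadamard (E h) (E j) $ y $ z * (?n * E k $ z $ x))"
    unfolding dual_distance_matrix_def trace_diagonal_hadamard
    using assms by (simp add: transpose_E E_sym[OF assms(3), of x])
  also have "\<dots> = ?n * ?n * (E k ** (hadamard (E h) (E j) ** E k)) $ x $ x"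
    by (simp add: matrix_matrix_mult_def sum_distrib_left mult_ac)
  also have "E k ** (hadamard (E h) (E j) ** E k) = matrix_scale (krein D E k h j / ?n) (E k)"
    unfolding hadamard_mult_E[OF assms]
    using assms(3) by (simp add: matrix_eq matrix_scale_vector_mult vector_scalar_commute E_E
        flip: matrix_vector_mul_assoc)
  finally show ?thesis
    by (simp add: matrix_scale_def)
qed

lemma E_dual_distance_matrix_E_eq_0:
  assumes "h \<le> D" "j \<le> D" "k \<le> D" and krein: "krein D E k h j = 0"
  shows "E h *v (dual_distance_matrix k *v (E j *v v)) = 0"
proof -
  let ?N = "E h ** dual_distance_matrix k ** E j"
  have "transpose ?N = E j ** dual_distance_matrix k ** E h"
    using assms by (simp add: matrix_transpose_mul transpose_E transpose_diagonal_matrix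
        dual_distance_matrix_def matrix_mul_assoc)
  then have "?N ** transpose ?N =
      (E h ** dual_distance_matrix k ** (E j ** E j) ** dual_distance_matrix k) ** E h"
    by (simp add: matrix_mul_assoc)
  then have "trace (?N ** transpose ?N) =
      trace (E h ** dual_distance_matrix k ** E j ** dual_distance_matrix k)"
    using assms trace_mul_sym[of _ "E h"]
    by (simp add: E_mult_E matrix_mul_assoc)
  then have "trace (?N ** transpose ?N) = 0"
    using assms by (simp add: trace_E_dual_distance_matrix)
  moreover have "?N $ y $ z \<in> \<real>" for y z
    unfolding matrix_matrix_mult_def dual_distance_matrix_def diagonal_matrix_def using assms
    by (auto intro!: sum_in_Reals Reals_mult E_real)
  ultimately have "?N = 0"
    by (intro trace_mult_transpose_eq_zero)
  then show ?thesis
    by (simp add: matrix_vector_mul_assoc matrix_mul_assoc)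
qed

lemma Es_distance_matrix_Es_eq_0:
  assumes "h > k + j \<or> j > k + h \<or> k > h + j"
  shows "Es h *v (distance_matrix k *v (Es j *v v)) = 0"
proof -
  have "distance_matrix k $ y $ z * (Es j *v v) $ z = 0" if "\<delta> x y = h" for y z
    using assms that dist_triangle[of x y z] dist_triangle[of x z y] dist_triangle[of y z x]
      dist_sym[of z y] dist_sym[of y x]
    by (auto simp: Es_vector_nth distance_matrix_def)
  then have "(distance_matrix k *v (Es j *v v)) $ y = 0" if "\<delta> x y = h" for y
    unfolding matrix_vector_mult_def[of "distance_matrix k"] using that by (simp add: sum.neutral)
  then show ?thesis
    by (simp add: vec_eq_iff Es_vector_nth[of h])
qed

definition \<theta>s :: "nat \<Rightarrow> real" where
  "\<theta>s d = of_nat CARD('v) * Re (E 1 $ x $ (SOME y. \<delta> x y = d))"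

lemma \<theta>s_dist: "of_real (\<theta>s (\<delta> x y)) = of_nat CARD('v) * E 1 $ x $ y"
proof -
  obtain f where f_nth: "\<And>y z. E 1 $ y $ z = of_real (f (\<delta> y z))"
    using E_nth[OF D_ge_1] by blast
  have "\<delta> x (SOME z. \<delta> x z = \<delta> x y) = \<delta> x y"
    by (rule someI) simp
  then show ?thesis
    by (simp add: \<theta>s_def f_nth del: One_nat_def)
qed

lemma As_vector_nth: "(As *v v) $ y = of_real (\<theta>s (\<delta> x y)) * v $ y"
  by (simp add: As_eq_dual_distance_matrix dual_distance_matrix_vector_nth \<theta>s_dist del: One_nat_def)

lemma \<theta>s_eq_imp_E_nth_eq:
  assumes \<theta>s_eq: "\<theta>s (\<delta> x y) = \<theta>s (\<delta> x z)" and k_le: "k \<le> D"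
  shows "E k $ x $ y = E k $ x $ z"
proof -
  have "As *v v = of_real (\<theta>s (\<delta> x y)) *s v" if "v \<in> {axis y 1, axis z 1}" for v
    using that \<theta>s_eq by (auto simp: vec_eq_iff As_vector_nth axis_def)
  then obtain c where c_scalar: "\<forall>v\<in>{axis y 1, axis z 1}. dual_distance_matrix k *v v = c *s v"
    by (rule generated_subalgebra_scalar_on[OF dual_distance.M_in_generated_subalgebra[OF k_le]])
  have "of_nat CARD('v) * E k $ x $ w = c" if "w \<in> {y, z}" for w
  proof -
    have "(dual_distance_matrix k *v axis w 1) $ w = (c *s axis w 1) $ w"
      using c_scalar that by auto
    then show ?thesis
      by (simp add: dual_distance_matrix_vector_nth axis_def)
  qed
  then have "of_nat CARD('v) * E k $ x $ y = of_nat CARD('v) * E k $ x $ z"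
    by simp
  then show ?thesis by simp
qed

lemma inj_\<theta>s: "inj_on \<theta>s {..D}"
proof (rule inj_onI)
  fix a b assume ab_eq: "a \<in> {..D}" "b \<in> {..D}" "\<theta>s a = \<theta>s b"
  obtain y z where dist_yz: "\<delta> x y = a" "\<delta> x z = b"
    using ab_eq dist_attained_from by (metis atMost_iff)
  obtain c where expansion: "distance_matrix a = (\<Sum>l\<le>D. matrix_scale (c l) (E l))"
    using ab_eq
    by (auto intro: generated_subalgebra_expansion[OF distance.M_in_generated_subalgebra])
  have "distance_matrix a $ x $ y = distance_matrix a $ x $ z"
    unfolding expansion using ab_eq dist_yz \<theta>s_eq_imp_E_nth_eq[of y z]
    by (simp add: matrix_scale_def)
  then show "a = b"
    using dist_yz by (auto simp: distance_matrix_def split: if_splits)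
qed

lemma self_adjoint_As: "self_adjoint ((*v) As)"
  unfolding As_eq_dual_distance_matrix
proof (rule self_adjoint_real_symmetric)
  show "dual_distance_matrix 1 $ y $ z \<in> \<real>" for y z
    using D_ge_1 by (auto simp: dual_distance_matrix_def diagonal_matrix_def E_real)
  show "transpose (dual_distance_matrix 1) = dual_distance_matrix 1"
    by (simp add: dual_distance_matrix_def transpose_diagonal_matrix)
qed

sublocale P: tridiagonal_system D A E \<theta> As
proof
  show "E h *v (As *v (E j *v v)) = 0" if "h \<le> D" "j \<le> D" "h > Suc j \<or> j > Suc h" for h j v
    unfolding As_eq_dual_distance_matrix using that D_ge_1
    by (intro E_dual_distance_matrix_E_eq_0 krein_eq_0) auto
qed

sublocale Q: tridiagonal_system D As Es \<theta>s A
proof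
  show "(\<Sum>i\<le>D. Es i *v v) = v" for v
    using dist_le_D by (simp add: vec_eq_iff Es_vector_nth)
  show "Es i *v (Es j *v v) = (if i = j then Es j *v v else 0)" for i j v
    by (simp add: vec_eq_iff Es_vector_nth)
  show "As *v (Es i *v v) = of_real (\<theta>s i) *s (Es i *v v)" for i v
    by (simp add: vec_eq_iff As_vector_nth Es_vector_nth)
  show "Es h *v (A *v (Es j *v v)) = 0" if "h > Suc j \<or> j > Suc h" for h j v
    unfolding A_eq_distance_matrix using that by (intro Es_distance_matrix_Es_eq_0) auto
qed (rule inj_\<theta>s)

sublocale wide_tridiagonal_pair D A E \<theta> As Es \<theta>s
proof
  show "self_adjoint ((*v) A)" "self_adjoint ((*v) As)"
    by (fact self_adjoint_A self_adjoint_As)+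
  fix W assume module: "matrix_module {A, As} W" "W \<noteq> {0}"
  show "D \<le> Min (supp W) + Max (supp W)"
  proof (rule Min_plus_Max_supp_ge[OF _ module(2)])
    show "matrix_module {A, dual_distance_matrix D} W"
      using module(1) dual_distance.matrix_module_M[of W D] by (auto simp: matrix_module_def)
    show "E h *v (dual_distance_matrix D *v (E j *v v)) = 0" if "h \<le> D" "j \<le> D" "h + j < D"
      for h j v
      using that by (intro E_dual_distance_matrix_E_eq_0 krein_eq_0) auto
  qed (rule dual_distance.M_D_inj)
  show "D \<le> Min (Q.supp W) + Max (Q.supp W)"
  proof (rule Q.Min_plus_Max_supp_ge[OF _ module(2)])
    show "matrix_module {As, distance_matrix D} W"
      using module(1) distance.matrix_module_M[of W D] by (auto simp: matrix_module_def)
    show "Es h *v (distance_matrix D *v (Es j *v v)) = 0" if "h + j < D" for h j v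
      using that by (intro Es_distance_matrix_Es_eq_0) auto
  qed (rule distance.M_D_inj)
qed

lemma displacement_eq:
  assumes "irreducible_matrix_module {A, As} W"
  shows "displacement adj E x W = int (Max (Q.supp W) + Min (supp W)) - int D"
  using Q.irreducible_Min_supp_plus_card[of W] assms
  by (simp add: displacement_def endpoint_def dual_endpoint_def module_diameter_def insert_commute
      flip: D_def)

lemma nucleus_part_eq_flags: "i \<le> D \<Longrightarrow> nucleus_part adj E x i = Q.flag i \<inter> flag (D - i)"
  by (simp add: nucleus_part_def sum_range_E_eq_flag Q.sum_range_E_eq_flag flip: D_def)

lemma nucleus_eq_span_irreducible:
  "nucleus adj E x =
    vec.span (\<Union>{W. irreducible_matrix_module {A, As} W \<and> Max (Q.supp W) + Min (supp W) = D})"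
proof -
  have "irreducible_matrix_module {A, As} W \<and> displacement adj E x W = 0 \<longleftrightarrow>
      irreducible_matrix_module {A, As} W \<and> Max (Q.supp W) + Min (supp W) = D" for W
    using displacement_eq[of W] by auto
  then show ?thesis
    by (simp add: nucleus_def T_algebra_def irreducible_matrix_module_generated)
qed

end

theorem theorem7p5:
  fixes adj :: "'v::finite \<Rightarrow> 'v \<Rightarrow> bool"
    and E :: "nat \<Rightarrow> complex^'v^'v"
    and x :: 'v
    and D :: nat
  assumes "D = graph_diameter adj"
    and "D \<ge> 1"
    and "distance_regular adj"
    and "idempotent_ordering adj E"
    and "Q_polynomial D E"
  shows "(\<Sum>i\<le>D. nucleus_part adj E x i) = nucleus adj E x"
proof -
  interpret distance_regular_graph adj D
    using assms(1-3) by unfold_locales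
  obtain \<theta> where "spectral_decomposition D A E \<theta>"
    using primitive_idempotents_spectral_decomposition[OF self_adjoint_A] assms(1,4)
    by (auto simp: idempotent_ordering_def)
  then interpret spectral_decomposition D A E \<theta> .
  interpret Q_polynomial_graph adj D E \<theta> x
    using assms(4,5) by unfold_locales (simp add: idempotent_ordering_def)
  have "(\<Sum>i\<le>D. nucleus_part adj E x i) = (\<Sum>i\<le>D. Q.flag i \<inter> flag (D - i))"
    by (simp add: nucleus_part_eq_flags)
  also have "\<dots> = split_sum D UNIV"
    by (rule sum_flags_eq_split_sum)
  also have "\<dots> = nucleus adj E x"
    unfolding nucleus_eq_span_irreducible by (rule split_sum_eq_span_irreducible)
  finally show ?thesis .
qed

end
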